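(* Let $H$ be a rank-one torsion-free abelian group, regarded as a subgroup of $\mathbb{Q}$ via a fixed embedding, and let $K$ be a non-trivial finite-rank torsion-free abelian group. Let $G$ be the ordered abelian group $H\oplus K$ with positive cone $G^+=\{(h,k)\in H\oplus K \mid h>0\}\cup\{0\}$. If $\operatorname{inner\,type} K\wedge \operatorname{type} H\neq \operatorname{type}\mathbb{Z}$, then $G$ is ultrasimplicial.
   Context: Rank means torsion-free rank, and independent means linearly independent over $\mathbb{Z}$. Ultrasimplicial: a simplicial group is a group $\mathbb{Z}^m$ (some finite $m$) with the coordinatewise order, i.e. positive cone $\mathbb{Z}_{\ge 0}^m$. A countable ordered abelian group is a dimension group if it is isomorphic, in the category of ordered abelian groups (with positive homomorphisms as morphisms), to the inductive limit of a sequence of simplicial groups. A dimension group is ultrasimplicial if it is isomorphic to such an inductive limit in which all the maps are injective. Types: let $A$ be a torsion-free abelian group and $a\in A$. For a prime $p$, the $p$-height $h_p^A(a)$ is $m$ if $a\in p^mA\setminus p^{m+1}A$ for some $m\ge 0$, and $\infty$ if there is no such $m$. The height of $a$ in $A$ is the sequence $(h_p^A(a))_{p}$ indexed by all primes. Sequences $(\alpha_p)_p$ with values in $\{0,1,2,\dots\}\cup\{\infty\}$ are ordered by $\alpha\le\beta$ iff $\alpha_p\le\beta_p$ for all $p$; this is a lattice order with pointwise minimum $\wedge$ and pointwise maximum $\vee$. Two such sequences are equivalent if they differ at only finitely many primes and, whenever $\alpha_p=\infty$ or $\beta_p=\infty$, one has $\alpha_p=\beta_p$. Equivalence classes are called types;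 the order and the operations $\wedge,\vee$ descend to types, which form a lattice. $\operatorname{type}_A(a)$ is the class of the height of $a$ in $A$. If $A$ has rank one, all non-zero elements have the same type, denoted $\operatorname{type}(A)$; in particular $\operatorname{type}\mathbb{Z}$ is the class of the zero sequence. Inner type: if $A$ is a finite-rank torsion-free abelian group and $x_1,\dots,x_n$ is a maximal independent subset of $A$, then $\operatorname{inner\,type}(A)=\bigwedge_{i=1}^n\operatorname{type}_A(x_i)$; this does not depend on the choice of maximal independent subset. *)

theory Defs
  imports
    "HOL-Algebra.FiniteProduct"
    "HOL-Algebra.Product_Groups"
    "HOL-Computational_Algebra.Primes"
    "HOL-Library.Extended_Nat"
    "HOL-Library.Countable_Set"
begin

text \<open>
  Abelian groups are commutative groups in the sense of HOL-Algebra, whose notation is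
  multiplicative: the sum \<open>a + b\<close> is written \<open>a \<otimes>\<^bsub>G\<^esub> b\<close>, and the multiple \<open>n a\<close> is
  written \<open>a [^]\<^bsub>G\<^esub> n\<close>.
\<close>

section \<open>Torsion-free groups and rank\<close>

definition torsion_free :: "('a, 'b) monoid_scheme \<Rightarrow> bool" where
  "torsion_free A \<longleftrightarrow>
     (\<forall>a\<in>carrier A. \<forall>n::nat. n > 0 \<longrightarrow> a [^]\<^bsub>A\<^esub> n = \<one>\<^bsub>A\<^esub> \<longrightarrow> a = \<one>\<^bsub>A\<^esub>)"

definition int_independent :: "('a, 'b) monoid_scheme \<Rightarrow> 'a set \<Rightarrow> bool" where
  "int_independent A S \<longleftrightarrow>
     S \<subseteq> carrier A \<and>
     (\<forall>T c. finite T \<longrightarrow> T \<subseteq> S \<longrightarrow>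
        (\<Otimes>\<^bsub>A\<^esub>x\<in>T. x [^]\<^bsub>A\<^esub> (c x :: int)) = \<one>\<^bsub>A\<^esub> \<longrightarrow> (\<forall>x\<in>T. c x = 0))"

definition maximal_int_independent :: "('a, 'b) monoid_scheme \<Rightarrow> 'a set \<Rightarrow> bool" where
  "maximal_int_independent A S \<longleftrightarrow>
     int_independent A S \<and> (\<forall>T. int_independent A T \<longrightarrow> S \<subseteq> T \<longrightarrow> T = S)"

definition has_rank :: "('a, 'b) monoid_scheme \<Rightarrow> nat \<Rightarrow> bool" where
  "has_rank A r \<longleftrightarrow> (\<exists>S. maximal_int_independent A S \<and> finite S \<and> card S = r)"

definition finite_rank :: "('a, 'b) monoid_scheme \<Rightarrow> bool" where
  "finite_rank A \<longleftrightarrow> (\<exists>r. has_rank A r)"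

definition rat_group :: "rat monoid" where
  "rat_group = \<lparr>carrier = UNIV, monoid.mult = (+), one = 0\<rparr>"


section \<open>Heights and types\<close>

typedef prime_nat = "{p::nat. Factorial_Ring.prime p}"
  morphisms nat_of_prime prime_of_nat
  using two_is_prime_nat by blast

text \<open>
  Indexing by a type of primes gives these sequences the library's pointwise order and lattice
  operations.
\<close>

type_synonym height_seq = "prime_nat \<Rightarrow> enat"

definition power_subset :: "('a, 'b) monoid_scheme \<Rightarrow> nat \<Rightarrow> 'a set" where
  "power_subset A n = (\<lambda>x. x [^]\<^bsub>A\<^esub> n) ` carrier A"

definition height :: "('a, 'b) monoid_scheme \<Rightarrow> 'a \<Rightarrow> height_seq" where
  "height A a = (\<lambda>q. let p = nat_of_prime q;
                         P = (\<lambda>m. a \<in> power_subset A (p ^ m) - power_subset A (p ^ (m + 1)))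
                     in if \<exists>m. P m then enat (THE m. P m) else \<infinity>)"

definition height_equiv :: "height_seq \<Rightarrow> height_seq \<Rightarrow> bool" where
  "height_equiv \<alpha> \<beta> \<longleftrightarrow>
     finite {p. \<alpha> p \<noteq> \<beta> p} \<and> (\<forall>p. \<alpha> p = \<infinity> \<or> \<beta> p = \<infinity> \<longrightarrow> \<alpha> p = \<beta> p)"

lemma height_equiv_refl: "height_equiv \<alpha> \<alpha>"
  by (simp add: height_equiv_def)

lemma height_equiv_sym: "height_equiv \<alpha> \<beta> \<Longrightarrow> height_equiv \<beta> \<alpha>"
  by (auto simp: height_equiv_def eq_commute[of "\<beta> _"])

lemma height_equiv_trans:
  assumes "height_equiv \<alpha> \<beta>" "height_equiv \<beta> \<gamma>"
  shows "height_equiv \<alpha> \<gamma>"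
proof -
  have "{p. \<alpha> p \<noteq> \<gamma> p} \<subseteq> {p. \<alpha> p \<noteq> \<beta> p} \<union> {p. \<beta> p \<noteq> \<gamma> p}"
    by auto
  then have "finite {p. \<alpha> p \<noteq> \<gamma> p}"
    using assms unfolding height_equiv_def by (meson finite_UnI finite_subset)
  then show ?thesis
    using assms unfolding height_equiv_def by metis
qed

lemma equivp_height_equiv: "equivp height_equiv"
  by (intro equivpI reflpI sympI transpI)
     (blast intro: height_equiv_refl height_equiv_sym height_equiv_trans)+

lemma height_equiv_inf:
  assumes "height_equiv \<alpha> \<alpha>'" "height_equiv \<beta> \<beta>'"
  shows "height_equiv (inf \<alpha> \<beta>) (inf \<alpha>' \<beta>')"
proof -
  have "{p. inf \<alpha> \<beta> p \<noteq> inf \<alpha>' \<beta>' p} \<subseteq> {p. \<alpha> p \<noteq> \<alpha>' p} \<union> {p. \<beta> p \<noteq> \<beta>' p}"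
    by auto
  then have "finite {p. inf \<alpha> \<beta> p \<noteq> inf \<alpha>' \<beta>' p}"
    using assms unfolding height_equiv_def by (meson finite_UnI finite_subset)
  moreover have "inf x y = \<infinity> \<longleftrightarrow> x = \<infinity> \<and> y = \<infinity>" for x y :: enat
    by (cases x; cases y) (simp_all add: inf_min)
  then have "inf \<alpha> \<beta> p = \<infinity> \<or> inf \<alpha>' \<beta>' p = \<infinity> \<longrightarrow> inf \<alpha> \<beta> p = inf \<alpha>' \<beta>' p" for p
    using assms unfolding height_equiv_def inf_fun_def by metis
  ultimately show ?thesis
    unfolding height_equiv_def by blast
qed

lemma height_equiv_sup:
  assumes "height_equiv \<alpha> \<alpha>'" "height_equiv \<beta> \<beta>'"
  shows "height_equiv (sup \<alpha> \<beta>) (sup \<alpha>' \<beta>')"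
proof -
  have "{p. sup \<alpha> \<beta> p \<noteq> sup \<alpha>' \<beta>' p} \<subseteq> {p. \<alpha> p \<noteq> \<alpha>' p} \<union> {p. \<beta> p \<noteq> \<beta>' p}"
    by auto
  then have "finite {p. sup \<alpha> \<beta> p \<noteq> sup \<alpha>' \<beta>' p}"
    using assms unfolding height_equiv_def by (meson finite_UnI finite_subset)
  moreover have "sup x y = \<infinity> \<longleftrightarrow> x = \<infinity> \<or> y = \<infinity>" for x y :: enat
    by (cases x; cases y) (simp_all add: sup_max)
  then have "sup \<alpha> \<beta> p = \<infinity> \<or> sup \<alpha>' \<beta>' p = \<infinity> \<longrightarrow> sup \<alpha> \<beta> p = sup \<alpha>' \<beta>' p" for p
    using assms unfolding height_equiv_def sup_fun_def by metis
  ultimately show ?thesis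
    unfolding height_equiv_def by blast
qed

quotient_type baer_type = height_seq / height_equiv
  by (rule equivp_height_equiv)

instantiation baer_type :: lattice
begin

lift_definition inf_baer_type :: "baer_type \<Rightarrow> baer_type \<Rightarrow> baer_type" is inf
  by (rule height_equiv_inf)

lift_definition sup_baer_type :: "baer_type \<Rightarrow> baer_type \<Rightarrow> baer_type" is sup
  by (rule height_equiv_sup)

definition less_eq_baer_type :: "baer_type \<Rightarrow> baer_type \<Rightarrow> bool" where
  "s \<le> t \<longleftrightarrow> (\<exists>\<alpha> \<beta>. s = abs_baer_type \<alpha> \<and> t = abs_baer_type \<beta> \<and> \<alpha> \<le> \<beta>)"

definition less_baer_type :: "baer_type \<Rightarrow> baer_type \<Rightarrow> bool" where
  "s < t \<longleftrightarrow> s \<le> t \<and> \<not> t \<le> (s :: baer_type)"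

instance
proof -
  have le_iff: "s \<le> t \<longleftrightarrow> inf s t = s" for s t :: baer_type
  proof
    assume "s \<le> t"
    then show "inf s t = s"
      by (auto simp: less_eq_baer_type_def inf_baer_type.abs_eq inf_absorb1)
  next
    assume *: "inf s t = s"
    obtain \<alpha> \<beta> where "s = abs_baer_type \<alpha>" "t = abs_baer_type \<beta>"
      by (metis Quotient_abs_rep Quotient_baer_type)
    then have "s = abs_baer_type (inf \<alpha> \<beta>)"
      using * by (simp add: inf_baer_type.abs_eq)
    then show "s \<le> t"
      using \<open>t = abs_baer_type \<beta>\<close> unfolding less_eq_baer_type_def by (metis inf_le2)
  qed
  have comm: "inf s t = inf t s" for s t :: baer_type
    by transfer (simp add: inf_commute height_equiv_refl)
  have assoc: "inf (inf s t) u = inf s (inf t u)" for s t u :: baer_type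
    by transfer (simp add: inf_assoc height_equiv_refl)
  have idem: "inf s s = s" for s :: baer_type
    by transfer (simp add: height_equiv_refl)
  have scomm: "sup s t = sup t s" for s t :: baer_type
    by transfer (simp add: sup_commute height_equiv_refl)
  have sassoc: "sup (sup s t) u = sup s (sup t u)" for s t u :: baer_type
    by transfer (simp add: sup_assoc height_equiv_refl)
  have absorb1: "inf s (sup s t) = s" for s t :: baer_type
    by transfer (simp add: inf_sup_absorb height_equiv_refl)
  have absorb2: "sup s (inf s t) = s" for s t :: baer_type
    by transfer (simp add: sup_inf_absorb height_equiv_refl)
  have le_iff': "s \<le> t \<longleftrightarrow> sup s t = t" for s t :: baer_type
    unfolding le_iff by (metis comm scomm absorb1 absorb2)
  show "OFCLASS(baer_type, lattice_class)"
  proof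
    fix s t u :: baer_type
    show "s < t \<longleftrightarrow> s \<le> t \<and> \<not> t \<le> s" by (rule less_baer_type_def)
    show "s \<le> s" by (simp add: le_iff idem)
    show "s \<le> u" if "s \<le> t" "t \<le> u" using that unfolding le_iff by (metis assoc)
    show "s = t" if "s \<le> t" "t \<le> s" using that unfolding le_iff by (metis comm)
    show "inf s t \<le> s" "inf s t \<le> t" unfolding le_iff by (metis assoc comm idem)+
    show "s \<le> inf t u" if "s \<le> t" "s \<le> u" using that unfolding le_iff by (metis assoc)
    show "s \<le> sup s t" "t \<le> sup s t" unfolding le_iff by (metis scomm absorb1)+
    show "sup t u \<le> s" if "t \<le> s" "u \<le> s" using that unfolding le_iff' by (metis sassoc)
  qed
qed

end

definition element_type :: "('a, 'b) monoid_scheme \<Rightarrow> 'a \<Rightarrow> baer_type" where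
  "element_type A a = abs_baer_type (height A a)"

text \<open>
  For a group of rank one, all non-zero elements have the same type, so the choice is immaterial;
  likewise below, for a group of finite rank, the inner type does not depend on the choice of the
  maximal independent set.  The meet of the empty family is left unspecified, so that
  \<open>inner_type\<close> is meaningful only for non-trivial groups.
\<close>

definition rank_one_type :: "('a, 'b) monoid_scheme \<Rightarrow> baer_type" where
  "rank_one_type A = element_type A (SOME a. a \<in> carrier A - {\<one>\<^bsub>A\<^esub>})"

definition inner_type :: "('a, 'b) monoid_scheme \<Rightarrow> baer_type" where
  "inner_type A =
     Inf_fin (element_type A ` (SOME S. maximal_int_independent A S \<and> finite S))"


section \<open>Ordered abelian groups\<close>

text \<open>
  An order on an abelian group is given by its positive cone: \<open>x \<le> y\<close> means
  \<open>y - x \<in> pos_cone G\<close>.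
\<close>

record 'a ordered_group = "'a monoid" +
  pos_cone :: "'a set"

definition with_cone :: "'a monoid \<Rightarrow> 'a set \<Rightarrow> 'a ordered_group" where
  "with_cone G P = \<lparr>carrier = carrier G, monoid.mult = monoid.mult G, one = one G, pos_cone = P\<rparr>"

definition ordered_abelian_group :: "('a, 'b) ordered_group_scheme \<Rightarrow> bool" where
  "ordered_abelian_group G \<longleftrightarrow>
     comm_group G \<and> pos_cone G \<subseteq> carrier G \<and> \<one>\<^bsub>G\<^esub> \<in> pos_cone G \<and>
     (\<forall>x\<in>pos_cone G. \<forall>y\<in>pos_cone G. x \<otimes>\<^bsub>G\<^esub> y \<in> pos_cone G) \<and>
     (\<forall>x\<in>pos_cone G. inv\<^bsub>G\<^esub> x \<in> pos_cone G \<longrightarrow> x = \<one>\<^bsub>G\<^esub>)"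

definition positive_hom ::
    "('a, 'c) ordered_group_scheme \<Rightarrow> ('b, 'd) ordered_group_scheme \<Rightarrow> ('a \<Rightarrow> 'b) set" where
  "positive_hom G H = {f \<in> hom G H. f ` pos_cone G \<subseteq> pos_cone H}"

definition ordered_isomorphic ::
    "('a, 'c) ordered_group_scheme \<Rightarrow> ('b, 'd) ordered_group_scheme \<Rightarrow> bool" where
  "ordered_isomorphic G H \<longleftrightarrow>
     (\<exists>f\<in>positive_hom G H. \<exists>g\<in>positive_hom H G.
        (\<forall>x\<in>carrier G. g (f x) = x) \<and> (\<forall>y\<in>carrier H. f (g y) = y))"

definition simplicial_group :: "nat \<Rightarrow> (nat \<Rightarrow> int) ordered_group" where
  "simplicial_group m =
     (let Z = product_group {..<m} (\<lambda>_. integer_group)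
      in with_cone Z {x \<in> carrier Z. \<forall>i<m. 0 \<le> x i})"


section \<open>Inductive limits of sequences\<close>

text \<open>
  A sequence consists of ordered groups \<open>A n\<close> and maps \<open>f n\<close> from \<open>A n\<close> to \<open>A (n + 1)\<close>; for
  \<open>i \<le> j\<close>, the map \<open>transition f i j\<close> is the composite from \<open>A i\<close> to \<open>A j\<close>.  The limit is the
  disjoint union of the \<open>A n\<close> modulo eventual equality, an element of \<open>A n\<close> being tagged with \<open>n\<close>;
  its positive cone consists of the classes of positive elements.  The union in the product of
  two classes is over equal classes.
\<close>

definition transition :: "(nat \<Rightarrow> 'a \<Rightarrow> 'a) \<Rightarrow> nat \<Rightarrow> nat \<Rightarrow> 'a \<Rightarrow> 'a" where
  "transition f i j = fold f [i..<j]"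

definition limit_rel ::
    "(nat \<Rightarrow> ('a, 'b) ordered_group_scheme) \<Rightarrow> (nat \<Rightarrow> 'a \<Rightarrow> 'a) \<Rightarrow> ((nat \<times> 'a) \<times> (nat \<times> 'a)) set"
  where
  "limit_rel A f =
     {((i, x), (j, y)). x \<in> carrier (A i) \<and> y \<in> carrier (A j) \<and>
        (\<exists>k. i \<le> k \<and> j \<le> k \<and> transition f i k x = transition f j k y)}"

definition inductive_limit ::
    "(nat \<Rightarrow> ('a, 'b) ordered_group_scheme) \<Rightarrow> (nat \<Rightarrow> 'a \<Rightarrow> 'a) \<Rightarrow> (nat \<times> 'a) set ordered_group"
  where
  "inductive_limit A f =
     \<lparr>carrier = (SIGMA n : UNIV. carrier (A n)) // limit_rel A f,
      monoid.mult = (\<lambda>C D.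
        \<Union>{limit_rel A f `` {(k, transition f i k x \<otimes>\<^bsub>A k\<^esub> transition f j k y)} | i x j y k.
            (i, x) \<in> C \<and> (j, y) \<in> D \<and> k = max i j}),
      one = limit_rel A f `` {(0, \<one>\<^bsub>A 0\<^esub>)},
      pos_cone = (SIGMA n : UNIV. pos_cone (A n)) // limit_rel A f\<rparr>"

definition simplicial_sequence :: "(nat \<Rightarrow> nat) \<Rightarrow> (nat \<Rightarrow> (nat \<Rightarrow> int) \<Rightarrow> (nat \<Rightarrow> int)) \<Rightarrow> bool" where
  "simplicial_sequence m f \<longleftrightarrow>
     (\<forall>n. f n \<in> positive_hom (simplicial_group (m n)) (simplicial_group (m (Suc n))))"

definition dimension_group :: "('a, 'b) ordered_group_scheme \<Rightarrow> bool" where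
  "dimension_group G \<longleftrightarrow>
     ordered_abelian_group G \<and> countable (carrier G) \<and>
     (\<exists>m f. simplicial_sequence m f \<and>
        ordered_isomorphic G (inductive_limit (\<lambda>n. simplicial_group (m n)) f))"

definition ultrasimplicial :: "('a, 'b) ordered_group_scheme \<Rightarrow> bool" where
  "ultrasimplicial G \<longleftrightarrow>
     dimension_group G \<and>
     (\<exists>m f. simplicial_sequence m f \<and>
        (\<forall>n. inj_on (f n) (carrier (simplicial_group (m n)))) \<and>
        ordered_isomorphic G (inductive_limit (\<lambda>n. simplicial_group (m n)) f))"

end

theory Submission
  imports Defs
begin

text \<open>
  Why the theorem holds.  Torsion-free groups of finite rank are groups of rational vectors, so
  \<open>G = H \<oplus> K\<close> may be seen inside some \<open>\<rat>\<^sup>I\<close>, a nonzero vector being in the positive cone exactly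
  when one distinguished coordinate, that of \<open>H\<close>, is positive.

  The hypothesis on types gives divisibility.  The meet of the inner type of \<open>K\<close> and the type of \<open>H\<close>
  is the type of a height sequence below the heights of a nonzero \<open>h\<^sub>0 \<in> H\<close> and of a maximal
  independent set of \<open>K\<close>.  As it is not the type of the integers, these finitely many elements have
  arbitrarily large common divisors (\<open>unbounded_common_divisors\<close>).  Every \<open>x \<in> G\<close> has a nonzero
  multiple \<open>d x\<close> in their span, so every single \<open>x\<close> is divisible in \<open>G\<close> by arbitrarily large integers.

  Divisibility gives simplicial cones.  Finitely many positive vectors always lie in the cone spanned
  by some positive independent elements of \<open>G\<close> (\<open>absorbing_cone\<close>).  Indeed, they lie in a lattice
  \<open>\<int>e \<oplus> F\<^sub>0\<close> inside \<open>G\<close>, where \<open>F\<^sub>0\<close> consists of vectors with distinguished coordinate \<open>0\<close>; dividing a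
  suitable \<open>e\<close> by a large integer and adding the result to a basis of \<open>F\<^sub>0\<close> gives such elements.

  As \<open>G\<close> is countable and generated by its positive elements, iterating this writes \<open>G\<close> as the union
  of an increasing sequence of simplicial groups whose cones exhaust the positive cone
  (\<open>ultrasimplicial_if_divisible_vectors\<close>), and such a union is the inductive limit of its members
  (\<open>ordered_isomorphic_inductive_limit\<close>).
\<close>

section \<open>Increasing unions as inductive limits\<close>

lemma transition_commutes:
  assumes "\<And>n. f n \<in> hom (A n) (A (Suc n))"
    and "\<And>n x. x \<in> carrier (A n) \<Longrightarrow> \<phi> (Suc n) (f n x) = \<phi> n x"
    and "i \<le> k" "x \<in> carrier (A i)"
  shows "transition f i k x \<in> carrier (A k) \<and> \<phi> k (transition f i k x) = \<phi> i x"
  using \<open>i \<le> k\<close>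
proof (induction k rule: dec_induct)
  case base
  then show ?case using assms(4) by (simp add: transition_def)
next
  case (step k)
  have "transition f i (Suc k) x = f k (transition f i k x)"
    using step(1) by (simp add: transition_def)
  then show ?case using step assms(1)[of k] assms(2)[of _ k] by (auto simp: hom_def)
qed

text \<open>
  When the \<open>A n\<close> embed compatibly into \<open>G\<close>, two elements are identified in the limit exactly when
  they have the same image in \<open>G\<close>.  Hence the elements of the limit are the fibres of the union of
  the embeddings, and sending \<open>g\<close> to the fibre over \<open>g\<close> is the isomorphism.
\<close>

lemma ordered_isomorphic_inductive_limit:
  fixes G :: "('a, 'c) ordered_group_scheme" and A :: "nat \<Rightarrow> ('b, 'd) ordered_group_scheme"
  assumes grp: "\<And>n. group (A n)"
    and G: "group G"
    and f: "\<And>n. f n \<in> hom (A n) (A (Suc n))"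
    and \<phi>: "\<And>n. \<phi> n \<in> hom (A n) G"
    and inj: "\<And>n. inj_on (\<phi> n) (carrier (A n))"
    and comm: "\<And>n x. x \<in> carrier (A n) \<Longrightarrow> \<phi> (Suc n) (f n x) = \<phi> n x"
    and cover: "carrier G = (\<Union>n. \<phi> n ` carrier (A n))"
    and sub: "\<And>n. pos_cone (A n) \<subseteq> carrier (A n)"
    and pos: "pos_cone G = (\<Union>n. \<phi> n ` pos_cone (A n))"
  shows "ordered_isomorphic G (inductive_limit A f)"
proof -
  note tr = transition_commutes[of f A \<phi>, OF f comm]
  define R where "R = limit_rel A f"
  define fiber where "fiber g = {(j, y). y \<in> carrier (A j) \<and> \<phi> j y = g}" for g
  have R: "((i, x), (j, y)) \<in> R \<longleftrightarrow>
      x \<in> carrier (A i) \<and> y \<in> carrier (A j) \<and> \<phi> i x = \<phi> j y" (is "?l = ?r") for i x j y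
  proof
    assume ?l
    then obtain k where "i \<le> k" "j \<le> k" "transition f i k x = transition f j k y"
      "x \<in> carrier (A i)" "y \<in> carrier (A j)"
      by (auto simp: R_def limit_rel_def)
    then show ?r using tr by metis
  next
    assume r: ?r
    let ?k = "max i j"
    have "transition f i ?k x = transition f j ?k y"
      using inj[of ?k] tr[of i ?k x] tr[of j ?k y] r by (simp add: inj_on_def)
    then show ?l using r by (auto simp: R_def limit_rel_def intro!: exI[of _ ?k])
  qed
  have cls: "R `` {(i, x)} = fiber (\<phi> i x)" if "x \<in> carrier (A i)" for i x
    using that by (auto simp: fiber_def R)
  have \<phi>c: "\<phi> i x \<in> carrier G" if "x \<in> carrier (A i)" for i x
    using that cover by auto
  have ne: "\<exists>i x. (i, x) \<in> fiber g" if "g \<in> carrier G" for g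
    using that cover by (auto simp: fiber_def)
  have inj_fiber: "inj_on fiber (carrier G)"
  proof (rule inj_onI)
    fix g h assume "g \<in> carrier G" "h \<in> carrier G" "fiber g = fiber h"
    then show "g = h" using ne[of g] by (auto simp: fiber_def)
  qed
  let ?L = "inductive_limit A f"
  have carL: "carrier ?L = fiber ` carrier G"
    unfolding inductive_limit_def using cls cover \<phi>c
    by (fastforce simp: quotient_def simp flip: R_def)
  have posL: "pos_cone ?L = fiber ` pos_cone G"
  proof -
    have "pos_cone ?L = (\<Union>n. \<Union>x\<in>pos_cone (A n). {R `` {(n, x)}})"
      by (auto simp: inductive_limit_def quotient_def simp flip: R_def)
    also have "\<dots> = (\<Union>n. \<Union>x\<in>pos_cone (A n). {fiber (\<phi> n x)})"
      using cls sub by (intro SUP_cong refl) auto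
    also have "\<dots> = fiber ` pos_cone G" by (auto simp: pos)
    finally show ?thesis .
  qed
  have multL: "fiber g \<otimes>\<^bsub>?L\<^esub> fiber h = fiber (g \<otimes>\<^bsub>G\<^esub> h)"
    if g: "g \<in> carrier G" and h: "h \<in> carrier G" for g h
  proof -
    have eq: "R `` {(max i j, transition f i (max i j) x \<otimes>\<^bsub>A (max i j)\<^esub> transition f j (max i j) y)}
          = fiber (g \<otimes>\<^bsub>G\<^esub> h)"
      if "(i, x) \<in> fiber g" "(j, y) \<in> fiber h" for i x j y
    proof -
      let ?k = "max i j"
      have x: "transition f i ?k x \<in> carrier (A ?k)" "\<phi> ?k (transition f i ?k x) = g"
        and y: "transition f j ?k y \<in> carrier (A ?k)" "\<phi> ?k (transition f j ?k y) = h"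
        using that tr[of i ?k x] tr[of j ?k y] by (auto simp: fiber_def)
      then show ?thesis
        using cls[of "transition f i ?k x \<otimes>\<^bsub>A ?k\<^esub> transition f j ?k y" ?k]
          grp[of ?k] hom_mult[OF \<phi>[of ?k] x(1) y(1)]
        by (simp add: group.is_monoid monoid.m_closed)
    qed
    obtain i x j y where "(i, x) \<in> fiber g" "(j, y) \<in> fiber h" using ne g h by meson
    then have fib: "(i, x) \<in> fiber g" "(j, y) \<in> fiber h" .
    let ?S = "{R `` {(k, transition f i k x \<otimes>\<^bsub>A k\<^esub> transition f j k y)} | i x j y k.
            (i, x) \<in> fiber g \<and> (j, y) \<in> fiber h \<and> k = max i j}"
    have "?S \<subseteq> {fiber (g \<otimes>\<^bsub>G\<^esub> h)}"
      by (intro subsetI, elim CollectE exE conjE) (simp only: eq singleton_iff)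
    moreover have "fiber (g \<otimes>\<^bsub>G\<^esub> h) \<in> ?S"
      using fib by (intro CollectI exI conjI) (rule eq[symmetric] refl | assumption)+
    ultimately have "?S = {fiber (g \<otimes>\<^bsub>G\<^esub> h)}"
      by (intro equalityI insert_subsetI empty_subsetI)
    moreover have "fiber g \<otimes>\<^bsub>?L\<^esub> fiber h = \<Union>?S"
      by (simp add: inductive_limit_def R_def)
    ultimately show ?thesis by simp
  qed
  have multG: "g \<otimes>\<^bsub>G\<^esub> h \<in> carrier G" if "g \<in> carrier G" "h \<in> carrier G" for g h
    using G that by (simp add: group.is_monoid monoid.m_closed)
  have subG: "pos_cone G \<subseteq> carrier G"
    unfolding pos cover using sub by fast
  let ?g = "the_inv_into (carrier G) fiber"
  have inv1: "?g (fiber x) = x" if "x \<in> carrier G" for x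
    using that inj_fiber by (simp add: the_inv_into_f_f)
  have "fiber \<in> positive_hom G ?L"
    unfolding positive_hom_def hom_def carL posL
    by (intro CollectI conjI ballI) (auto simp only: multL Pi_iff imageI)
  moreover have "?g \<in> hom ?L G"
  proof (rule homI)
    show "?g x \<in> carrier G" if "x \<in> carrier ?L" for x
      using that inv1 unfolding carL by force
    show "?g (x \<otimes>\<^bsub>?L\<^esub> y) = ?g x \<otimes>\<^bsub>G\<^esub> ?g y"
      if xy: "x \<in> carrier ?L" "y \<in> carrier ?L" for x y
    proof -
      obtain g h where "g \<in> carrier G" "x = fiber g" "h \<in> carrier G" "y = fiber h"
        using xy unfolding carL by blast
      then show ?thesis by (simp only: multL multG inv1)
    qed
  qed
  then have "?g \<in> positive_hom ?L G"
    unfolding positive_hom_def posL using inv1 subG by force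
  ultimately show ?thesis
    unfolding ordered_isomorphic_def 
    using inv1 by (intro bexI[of _ fiber] bexI[of _ ?g] conjI) (auto simp only: carL)
qed

section \<open>Lattices in rational coordinate spaces\<close>

definition lincomb :: "nat \<Rightarrow> (nat \<Rightarrow> int) \<Rightarrow> (nat \<Rightarrow> 'i \<Rightarrow> rat) \<Rightarrow> 'i \<Rightarrow> rat" where
  "lincomb m c b = (\<lambda>i. \<Sum>j<m. of_int (c j) * b j i)"

definition lattice_independent :: "nat \<Rightarrow> (nat \<Rightarrow> 'i \<Rightarrow> rat) \<Rightarrow> bool" where
  "lattice_independent m b \<longleftrightarrow> (\<forall>c. lincomb m c b = (\<lambda>_. 0) \<longrightarrow> (\<forall>j<m. c j = 0))"

definition vector_group :: "('i \<Rightarrow> rat) set \<Rightarrow> bool" where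
  "vector_group V \<longleftrightarrow> (\<lambda>_. 0) \<in> V \<and> (\<forall>x\<in>V. \<forall>y\<in>V. (\<lambda>i. x i - y i) \<in> V)"

lemma vector_group_diff:
  "vector_group V \<Longrightarrow> x \<in> V \<Longrightarrow> y \<in> V \<Longrightarrow> (\<lambda>i. x i - y i) \<in> V"
  by (simp add: vector_group_def)

lemma vector_group_add:
  assumes V: "vector_group V" and "x \<in> V" "y \<in> V"
  shows "(\<lambda>i. x i + y i) \<in> V"
proof -
  have "(\<lambda>i. 0 - y i) \<in> V" using assms by (auto simp: vector_group_def)
  from vector_group_diff[OF V \<open>x \<in> V\<close> this] show ?thesis by simp
qed

lemma vector_group_mult:
  assumes V: "vector_group V" and x: "x \<in> V"
  shows "(\<lambda>i. of_int a * x i) \<in> V"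
proof (induction a rule: int_induct[of _ 0])
  case base
  then show ?case using V by (simp add: vector_group_def)
next
  case (step1 a)
  from vector_group_add[OF V step1(2) x] show ?case by (simp add: distrib_right)
next
  case (step2 a)
  from vector_group_diff[OF V step2(2) x] show ?case by (simp add: left_diff_distrib)
qed

lemma vector_group_sum:
  assumes V: "vector_group V" and "finite J" "\<And>j. j \<in> J \<Longrightarrow> b j \<in> V"
  shows "(\<lambda>i. \<Sum>j\<in>J. of_int (c j) * b j i) \<in> V"
  using assms(2,3)
proof (induction J rule: finite_induct)
  case empty
  then show ?case using V by (simp add: vector_group_def)
next
  case (insert j J)
  then show ?case
    using vector_group_add[OF V vector_group_mult[OF V, of "b j" "c j"]] by simp
qed

lemma vector_group_lincomb:
  "vector_group V \<Longrightarrow> (\<And>j. j < m \<Longrightarrow> b j \<in> V) \<Longrightarrow> lincomb m c b \<in> V"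
  unfolding lincomb_def by (rule vector_group_sum) auto

lemma lattice_independentD:
  "lattice_independent m b \<Longrightarrow> lincomb m c b = (\<lambda>_. 0) \<Longrightarrow> j < m \<Longrightarrow> c j = 0"
  unfolding lattice_independent_def by (drule spec, drule mp, assumption) (drule spec, erule mp)

lemma lattice_independent_unique:
  assumes "lattice_independent m b" "lincomb m c b = lincomb m c' b" "j < m"
  shows "c j = c' j"
proof -
  have "lincomb m (\<lambda>j. c j - c' j) b = (\<lambda>_. 0)"
    using assms(2) by (simp add: lincomb_def fun_eq_iff left_diff_distrib sum_subtractf)
  from lattice_independentD[OF assms(1) this assms(3)] show ?thesis by simp
qed

text \<open>
  The values of one coordinate on a group of vectors with bounded denominators form a discrete,
  hence cyclic, group of rationals.
\<close>

lemma coordinate_generator: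
  fixes V :: "('i \<Rightarrow> rat) set" and D :: nat
  assumes V: "vector_group V" and D: "D > 0"
    and int: "\<forall>x\<in>V. \<forall>i. of_nat D * x i \<in> \<int>"
    and z: "z \<in> V" "z l \<noteq> 0"
  obtains e where "e \<in> V" "e l > 0" "\<And>x. x \<in> V \<Longrightarrow> \<exists>a::int. x l = of_int a * e l"
proof -
  define P where "P t \<longleftrightarrow> (\<exists>e\<in>V. e l > 0 \<and> of_nat D * e l = of_nat t)" for t :: nat
  have nat: "\<exists>t::nat. of_nat D * x l = of_nat t" if "x \<in> V" "x l > 0" for x
  proof -
    have "of_nat D * x l \<in> \<int>" using int that(1) by blast
    then obtain t :: int where t: "of_nat D * x l = of_int t" by (rule Ints_cases)
    moreover have "of_nat D * x l > 0" using that D by simp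
    ultimately have "of_nat D * x l = of_nat (nat t)" by simp
    then show ?thesis ..
  qed
  have "\<exists>y\<in>V. y l > 0"
  proof (cases "z l > 0")
    case False
    then show ?thesis
      using z vector_group_mult[OF V z(1), of "-1"] by (intro bexI[of _ "\<lambda>i. - z i"]) auto
  qed (use z in auto)
  then have "\<exists>t. P t" using nat unfolding P_def by metis
  then have "P (LEAST t. P t)" by (rule LeastI_ex)
  then obtain e where e: "e \<in> V" "e l > 0" "of_nat D * e l = of_nat (LEAST t. P t)"
    unfolding P_def by blast
  have "\<exists>a::int. x l = of_int a * e l" if x: "x \<in> V" for x
  proof -
    define a where "a = \<lfloor>x l / e l\<rfloor>"
    define y where "y = (\<lambda>i. x i - of_int a * e i)"
    have y: "y \<in> V" unfolding y_def by (intro vector_group_diff vector_group_mult V x e)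
    have "of_int a \<le> x l / e l" "x l / e l < of_int a + 1" unfolding a_def by linarith+
    then have "0 \<le> y l" "y l < e l" using e(2) by (auto simp: y_def field_simps)
    have "\<not> 0 < y l"
    proof
      assume "0 < y l"
      with nat y obtain t where "of_nat D * y l = of_nat t" by blast
      then have "P t" using y \<open>0 < y l\<close> unfolding P_def by blast
      then have "(LEAST t. P t) \<le> t" by (rule Least_le)
      then have "of_nat D * e l \<le> of_nat D * y l"
        using e(3) \<open>of_nat D * y l = of_nat t\<close> by simp
      then show False using D \<open>y l < e l\<close> by simp
    qed
    then have "x l = of_int a * e l" using \<open>0 \<le> y l\<close> by (simp add: y_def)
    then show ?thesis by (rule exI)
  qed
  then show ?thesis using that e(1,2) by simp
qed

text \<open>
  A group of vectors with bounded denominators is free, with a triangular basis: a vector \<open>e\<close> whose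
  coordinate \<open>l\<close> generates the values of that coordinate splits off the subgroup where it vanishes,
  and this subgroup has fewer coordinates.
\<close>

lemma lattice_basis:
  fixes V :: "('i \<Rightarrow> rat) set" and D :: nat
  assumes "finite I" and D: "D > 0"
    and "vector_group V" "\<forall>x\<in>V. \<forall>i. of_nat D * x i \<in> \<int>"
    and "\<forall>x\<in>V. \<forall>i. i \<notin> I \<longrightarrow> x i = 0"
  shows "\<exists>m b. (\<forall>j<m. b j \<in> V) \<and> lattice_independent m b \<and> (\<forall>x\<in>V. \<exists>c. x = lincomb m c b)"
  using assms(1,3-5)
proof (induction I arbitrary: V rule: finite_induct)
  case empty
  then have "\<forall>x\<in>V. x = lincomb 0 c b" for c :: "nat \<Rightarrow> int" and b :: "nat \<Rightarrow> 'i \<Rightarrow> rat"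
    by (auto simp: lincomb_def)
  then show ?case
    by (intro exI[of _ 0] exI[of _ "\<lambda>_ _. 0"]) (auto simp: lattice_independent_def)
next
  case (insert l I)
  note V = insert.prems(1)
  define V0 where "V0 = {x\<in>V. x l = 0}"
  have V0: "vector_group V0" using V by (auto simp: V0_def vector_group_def)
  have supp: "\<forall>x\<in>V0. \<forall>i. i \<notin> I \<longrightarrow> x i = 0"
    using insert.prems(3) by (auto simp: V0_def)
  have "\<forall>x\<in>V0. \<forall>i. of_nat D * x i \<in> \<int>" using insert.prems(2) by (auto simp: V0_def)
  from insert.IH[OF V0 this supp] obtain m b where
    b: "\<And>j. j < m \<Longrightarrow> b j \<in> V0" and ind: "lattice_independent m b"
    and span: "\<And>x. x \<in> V0 \<Longrightarrow> \<exists>c. x = lincomb m c b" by metis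
  show ?case
  proof (cases "\<exists>z\<in>V. z l \<noteq> 0")
    case False
    then have "V0 = V" by (auto simp: V0_def)
    then show ?thesis using b ind span by (intro exI[of _ m] exI[of _ b]) simp
  next
    case True
    then obtain e where e: "e \<in> V" "e l > 0" "\<And>x. x \<in> V \<Longrightarrow> \<exists>a::int. x l = of_int a * e l"
      using coordinate_generator[OF V D insert.prems(2)] by metis
    define b' where "b' = b(m := e)"
    have lc: "lincomb (Suc m) c b' i = lincomb m c b i + of_int (c m) * e i" for c i
      by (simp add: lincomb_def b'_def)
    have lc0: "lincomb m c b l = 0" for c using vector_group_lincomb[OF V0 b] by (simp add: V0_def)
    have "\<forall>j<Suc m. b' j \<in> V" using b e by (auto simp: b'_def V0_def less_Suc_eq)
    moreover have "lattice_independent (Suc m) b'"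
      unfolding lattice_independent_def
    proof (intro allI impI)
      fix c j assume c: "lincomb (Suc m) c b' = (\<lambda>_. 0)" and j: "j < Suc m"
      have "c m = 0" using fun_cong[OF c, of l] e(2) unfolding lc lc0 by simp
      then have "lincomb m c b = (\<lambda>_. 0)" using c lc by (auto simp: fun_eq_iff)
      then show "c j = 0"
        using lattice_independentD[OF ind, of c j] j \<open>c m = 0\<close> by (cases "j = m") auto
    qed
    moreover have "\<exists>c. x = lincomb (Suc m) c b'" if x: "x \<in> V" for x
    proof -
      obtain a where a: "x l = of_int a * e l" using e(3) x by blast
      have "(\<lambda>i. x i - of_int a * e i) \<in> V0"
        using a vector_group_diff[OF V x vector_group_mult[OF V e(1)]] by (simp add: V0_def)
      then obtain c where c: "(\<lambda>i. x i - of_int a * e i) = lincomb m c b" using span by blast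
      have "lincomb m (c(m := a)) b = lincomb m c b" by (simp add: lincomb_def)
      then have "x = lincomb (Suc m) (c(m := a)) b'"
        unfolding fun_eq_iff lc by (simp flip: c)
      then show ?thesis by blast
    qed
    ultimately show ?thesis by (intro exI[of _ "Suc m"] exI[of _ b'] conjI ballI)
  qed
qed

lemma common_denominator:
  fixes X :: "rat set"
  assumes "finite X"
  obtains D :: nat where "D > 0" "\<And>x. x \<in> X \<Longrightarrow> of_nat D * x \<in> \<int>"
proof -
  have "\<exists>D::nat. D > 0 \<and> (\<forall>x\<in>X. of_nat D * x \<in> \<int>)"
    using assms
  proof (induction X rule: finite_induct)
    case (insert x X)
    then obtain D :: nat where D: "D > 0" "\<forall>x\<in>X. of_nat D * x \<in> \<int>" by blast
    obtain a b :: int where x: "x = of_int a / of_int b" "b > 0"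
      by (metis quotient_of_denom_pos' quotient_of_div surj_pair snd_conv)
    have b: "rat_of_nat (nat b) = of_int b" using x by simp
    have "of_nat (D * nat b) * y \<in> \<int>" if y: "y \<in> insert x X" for y
    proof -
      consider "y = x" | "of_nat D * y \<in> \<int>" using y D by blast
      then show ?thesis
      proof cases
        case 1
        then have "of_nat (D * nat b) * y = of_int (int D * a)" using x by (simp add: b)
        then show ?thesis by (metis Ints_of_int)
      next
        case 2
        then have "of_nat (nat b) * (of_nat D * y) \<in> \<int>" by (rule Ints_mult[OF Ints_of_nat])
        then show ?thesis by (simp only: of_nat_mult mult_ac)
      qed
    qed
    then show ?case using D x by (intro exI[of _ "D * nat b"]) auto
  qed (auto intro: exI[of _ "1::nat"])
  then show ?thesis using that by blast
qed

section \<open>Simplicial cones that absorb finitely many positive vectors\<close>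

text \<open>
  This is the heart of the matter.  The given vectors lie in a lattice \<open>F\<close> with a basis
  \<open>e, f\<^sub>1, \<dots>, f\<^sub>m\<close>, where \<open>e\<close> is positive and the \<open>f\<^sub>j\<close> have coordinate \<open>l\<close> equal to \<open>0\<close>.  Replacing
  \<open>e\<close> by \<open>e' = e - k (f\<^sub>1 + \<dots> + f\<^sub>m)\<close> for large \<open>k\<close> makes all coordinates of the given vectors
  nonnegative, say \<open>x = a e' + \<Sum> \<beta>\<^sub>j f\<^sub>j\<close> with \<open>a \<ge> 1\<close>, but the \<open>f\<^sub>j\<close> are not positive.  Now divide
  \<open>e'\<close> by some \<open>N\<close> that exceeds every \<open>\<Sum> \<beta>\<^sub>j\<close>: the vectors \<open>e'/N\<close> and \<open>e'/N + f\<^sub>j\<close> are positive and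
  independent, and \<open>x = \<Sum> \<beta>\<^sub>j (e'/N + f\<^sub>j) + (N a - \<Sum> \<beta>\<^sub>j) e'/N\<close>.  Divisibility is assumed for
  all vectors of \<open>V\<close> because \<open>e'\<close> depends on the given ones.
\<close>

lemma absorbing_cone:
  fixes V :: "('i \<Rightarrow> rat) set"
  assumes V: "vector_group V" and I: "finite I" "\<forall>x\<in>V. \<forall>i. i \<notin> I \<longrightarrow> x i = 0"
    and divisible: "\<And>x M. x \<in> V \<Longrightarrow> \<exists>N>M. (\<lambda>i. x i / of_nat N) \<in> V"
    and X: "finite X" "X \<subseteq> V" "\<And>x. x \<in> X \<Longrightarrow> x l > 0"
  shows "\<exists>m b. (\<forall>j<m. b j \<in> V \<and> b j l > 0) \<and> lattice_independent m b \<and>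
           (\<forall>x\<in>X. \<exists>c. (\<forall>j<m. c j \<ge> 0) \<and> x = lincomb m c b)"
proof (cases "X = {}")
  case True
  show ?thesis by (intro exI[of _ 0]) (simp add: True lattice_independent_def)
next
  case False
  obtain D :: nat where D: "D > 0" "\<And>x i. x \<in> X \<Longrightarrow> i \<in> I \<Longrightarrow> of_nat D * x i \<in> \<int>"
    using common_denominator[of "(\<lambda>(x, i). x i) ` (X \<times> I)"] X(1) I(1)
    by (metis (no_types, lifting) SigmaI finite_SigmaI finite_imageI image_eqI case_prod_conv)
  define F where "F = {x\<in>V. \<forall>i. of_nat D * x i \<in> \<int>}"
  have F: "vector_group F"
    using V by (auto simp: F_def vector_group_def right_diff_distrib)
  have Fint: "\<forall>x\<in>F. \<forall>i. of_nat D * x i \<in> \<int>" by (simp add: F_def)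
  have "of_nat D * x i \<in> \<int>" if "x \<in> X" for x i
  proof (cases "i \<in> I")
    case False
    then have "x i = 0" using I(2) X(2) that by blast
    then show ?thesis by simp
  qed (use D(2) that in auto)
  then have XF: "x \<in> F" if "x \<in> X" for x using X that by (auto simp: F_def)
  obtain z where "z \<in> X" using False by blast
  then obtain e where e: "e \<in> F" "e l > 0" "\<And>x. x \<in> F \<Longrightarrow> \<exists>a::int. x l = of_int a * e l"
    using coordinate_generator[OF F D(1) Fint, of z l] XF X(3) by (metis less_irrefl)
  define F0 where "F0 = {x\<in>F. x l = 0}"
  have F0: "vector_group F0" using F by (auto simp: F0_def vector_group_def)
  obtain m b where b: "\<And>j. j < m \<Longrightarrow> b j \<in> F0" and ind: "lattice_independent m b"
    and span: "\<And>x. x \<in> F0 \<Longrightarrow> \<exists>c. x = lincomb m c b"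
  proof -
    have "\<forall>x\<in>F0. \<forall>i. of_nat D * x i \<in> \<int>" "\<forall>x\<in>F0. \<forall>i. i \<notin> I \<longrightarrow> x i = 0"
      using I(2) by (auto simp: F0_def F_def)
    from lattice_basis[OF I(1) D(1) F0 this] show ?thesis using that by blast
  qed
  have b_l: "b j l = 0" if "j < m" for j using b[OF that] by (simp add: F0_def)
  have "\<exists>a c. a > 0 \<and> (\<forall>i. x i = of_int a * e i + lincomb m c b i)" if x: "x \<in> X" for x
  proof -
    obtain a where a: "x l = of_int a * e l" using e(3) XF x by blast
    then have "a > 0" using X(3)[OF x] e(2) by (simp add: zero_less_mult_iff)
    moreover have "(\<lambda>i. x i - of_int a * e i) \<in> F0"
      using a vector_group_diff[OF F XF[OF x] vector_group_mult[OF F e(1)]] by (simp add: F0_def)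
    then obtain c where "(\<lambda>i. x i - of_int a * e i) = lincomb m c b" using span by blast
    then have "\<forall>i. x i = of_int a * e i + lincomb m c b i" by (auto simp: fun_eq_iff algebra_simps)
    ultimately show ?thesis by blast
  qed
  then obtain a c where a: "\<And>x. x \<in> X \<Longrightarrow> a x > (0::int)"
    and xc: "\<And>x i. x \<in> X \<Longrightarrow> x i = of_int (a x) * e i + lincomb m (c x) b i" by metis
  \<comment> \<open>any upper bound of all \<open>\<bar>c x j\<bar>\<close> serves, because every \<open>a x\<close> is at least \<open>1\<close>\<close>
  define k where "k = (\<Sum>x\<in>X. \<Sum>j<m. \<bar>c x j\<bar>)"
  have "\<bar>c x j\<bar> \<le> k" if "x \<in> X" "j < m" for x j
  proof -
    have "\<bar>c x j\<bar> \<le> (\<Sum>j<m. \<bar>c x j\<bar>)" using that by (intro member_le_sum) auto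
    also have "\<dots> \<le> k" unfolding k_def
      using that X(1) by (intro member_le_sum[of x X "\<lambda>x. \<Sum>j<m. \<bar>c x j\<bar>"]) (auto intro: sum_nonneg)
    finally show ?thesis .
  qed
  moreover have "k \<le> k * a x" if "x \<in> X" for x
  proof -
    have "k \<ge> 0" unfolding k_def by (intro sum_nonneg) auto
    then show ?thesis using a[OF that] by (simp add: mult_le_cancel_left1)
  qed
  ultimately have \<beta>_pos: "c x j + k * a x \<ge> 0" if "x \<in> X" "j < m" for x j
    using that by (smt (verit) abs_ge_minus_self)
  define \<beta> where "\<beta> x j = c x j + k * a x" for x j
  define e' where "e' = (\<lambda>i. e i - lincomb m (\<lambda>_. k) b i)"
  have lk: "lincomb m d b \<in> F0" for d by (rule vector_group_lincomb[OF F0 b])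
  have "e' \<in> F" unfolding e'_def
    using vector_group_diff[OF F e(1)] lk by (simp add: F0_def)
  have e'_l: "e' l = e l" using lk by (simp add: e'_def F0_def)
  have x\<beta>: "x i = of_int (a x) * e' i + lincomb m (\<beta> x) b i" if "x \<in> X" for x i
    using xc[OF that, of i]
    by (simp add: e'_def \<beta>_def lincomb_def algebra_simps sum.distrib sum_distrib_left)
  obtain N where N: "N > nat (\<Sum>x\<in>X. \<Sum>j<m. \<beta> x j)" "(\<lambda>i. e' i / of_nat N) \<in> V"
    using divisible \<open>e' \<in> F\<close> unfolding F_def by blast
  have N0: "N > 0" using N(1) by linarith
  define b' where "b' j = (\<lambda>i. e' i / of_nat N + (if j < m then b j i else 0))" for j
  have lc: "lincomb (Suc m) d b' i = of_int (\<Sum>j<Suc m. d j) * (e' i / of_nat N) + lincomb m d b i"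
    for d i
  proof -
    define q where "q = e' i / of_nat N"
    have "(\<Sum>j<m. of_int (d j) * b' j i) = (\<Sum>j<m. of_int (d j) * q) + lincomb m d b i"
      by (simp add: b'_def lincomb_def distrib_left sum.distrib flip: q_def)
    moreover have "b' m i = q" by (simp add: b'_def q_def)
    ultimately show ?thesis
      unfolding q_def[symmetric] by (simp add: lincomb_def sum_distrib_right distrib_right)
  qed
  have "b' j \<in> V \<and> b' j l > 0" if "j < Suc m" for j
  proof
    have "b j \<in> V" if "j < m" using b[OF that] by (simp add: F0_def F_def)
    then show "b' j \<in> V"
      unfolding b'_def using vector_group_add[OF V N(2), of "b j"] N(2) by (cases "j < m") auto
    show "b' j l > 0" using b_l[of j] e'_l e(2) N0 by (simp add: b'_def)
  qed
  moreover have "lattice_independent (Suc m) b'"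
    unfolding lattice_independent_def
  proof (intro allI impI)
    fix d j assume d: "lincomb (Suc m) d b' = (\<lambda>_. 0)" and j: "j < Suc m"
    have "of_int (\<Sum>j<Suc m. d j) * (e l / of_nat N) = 0"
      using fun_cong[OF d, of l] lk[of d] unfolding lc e'_l by (simp add: F0_def)
    then have s: "(\<Sum>j<Suc m. d j) = 0" using e(2) N0 by (auto simp del: of_int_sum)
    then have "lincomb m d b = (\<lambda>_. 0)"
      using d by (auto simp: fun_eq_iff lc simp del: sum.lessThan_Suc of_int_sum)
    then have "\<forall>j<m. d j = 0" using lattice_independentD[OF ind] by blast
    then show "d j = 0" using s j by (auto simp: less_Suc_eq)
  qed
  moreover have "\<exists>d. (\<forall>j<Suc m. d j \<ge> 0) \<and> x = lincomb (Suc m) d b'" if x: "x \<in> X" for x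
  proof -
    define d where "d = (\<beta> x)(m := int N * a x - (\<Sum>j<m. \<beta> x j))"
    have "(\<Sum>j<m. \<beta> x j) \<le> (\<Sum>x\<in>X. \<Sum>j<m. \<beta> x j)"
      using x X(1) \<beta>_pos
      by (intro member_le_sum[of x X "\<lambda>x. \<Sum>j<m. \<beta> x j"]) (auto simp: \<beta>_def intro!: sum_nonneg)
    also have "\<dots> \<le> int N" using N(1) by linarith
    also have "\<dots> \<le> int N * a x" using a[OF x] by (simp add: mult_le_cancel_left1)
    finally have "\<forall>j<Suc m. d j \<ge> 0" using \<beta>_pos[OF x] by (auto simp: d_def \<beta>_def less_Suc_eq)
    moreover have "x = lincomb (Suc m) d b'"
    proof
      fix i
      have s: "(\<Sum>j<Suc m. d j) = int N * a x" by (simp add: d_def)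
      have "lincomb m d b = lincomb m (\<beta> x) b" by (simp add: lincomb_def d_def)
      then show "x i = lincomb (Suc m) d b' i"
        unfolding lc s x\<beta>[OF x, of i] using N0 by simp
    qed
    ultimately show ?thesis by blast
  qed
  ultimately show ?thesis by (intro exI[of _ "Suc m"] exI[of _ b']) simp
qed

section \<open>Ordered groups of divisible vectors are ultrasimplicial\<close>

lemma simplicial_group_simps:
  "carrier (simplicial_group m) = {..<m} \<rightarrow>\<^sub>E UNIV"
  "x \<otimes>\<^bsub>simplicial_group m\<^esub> y = (\<lambda>i\<in>{..<m}. x i + y i)"
  "pos_cone (simplicial_group m) = {x \<in> {..<m} \<rightarrow>\<^sub>E UNIV. \<forall>i<m. 0 \<le> x i}"
  by (simp_all add: simplicial_group_def with_cone_def Let_def)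

lemma group_simplicial_group: "group (simplicial_group m)"
proof -
  let ?Z = "product_group {..<m} (\<lambda>_. integer_group)"
  interpret Z: group ?Z by simp
  show ?thesis
    by (rule groupI)
      (use Z.m_closed Z.one_closed Z.m_assoc Z.l_one Z.l_inv_ex in
        \<open>simp_all add: simplicial_group_def with_cone_def Let_def\<close>)
qed

lemma ultrasimplicialI:
  fixes G :: "('a, 'c) ordered_group_scheme"
  assumes "ordered_abelian_group G" "countable (carrier G)" "simplicial_sequence m f"
    and "\<And>n. inj_on (f n) (carrier (simplicial_group (m n)))"
    and "ordered_isomorphic G (inductive_limit (\<lambda>n. simplicial_group (m n)) f)"
  shows "ultrasimplicial G"
  unfolding ultrasimplicial_def dimension_group_def using assms by blast

context
  fixes G :: "('a, 'c) monoid_scheme" and E :: "'a \<Rightarrow> 'i \<Rightarrow> rat"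
  assumes G: "group G"
    and E_mult: "\<And>x y. x \<in> carrier G \<Longrightarrow> y \<in> carrier G \<Longrightarrow> E (x \<otimes>\<^bsub>G\<^esub> y) = (\<lambda>i. E x i + E y i)"
begin

interpretation G: group G by (rule G)

lemma coordinates_one: "E \<one>\<^bsub>G\<^esub> = (\<lambda>_. 0)"
  using E_mult[of "\<one>\<^bsub>G\<^esub>" "\<one>\<^bsub>G\<^esub>"] by (simp add: fun_eq_iff)

lemma coordinates_inv:
  assumes "x \<in> carrier G"
  shows "E (inv\<^bsub>G\<^esub> x) i = - E x i"
proof -
  have "(\<lambda>i. E x i + E (inv\<^bsub>G\<^esub> x) i) = (\<lambda>_. 0)"
    using E_mult[of x "inv\<^bsub>G\<^esub> x"] coordinates_one assms by simp
  from fun_cong[OF this, of i] show ?thesis by linarith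
qed

lemma vector_group_coordinates: "vector_group (E ` carrier G)"
  unfolding vector_group_def
proof (intro conjI ballI)
  show "(\<lambda>_. 0) \<in> E ` carrier G" using coordinates_one by (metis G.one_closed image_eqI)
  fix v w assume "v \<in> E ` carrier G" "w \<in> E ` carrier G"
  then obtain x y where xy: "x \<in> carrier G" "v = E x" "y \<in> carrier G" "w = E y" by auto
  then have "(\<lambda>i. v i - w i) = E (x \<otimes>\<^bsub>G\<^esub> inv\<^bsub>G\<^esub> y)"
    by (simp add: E_mult coordinates_inv fun_eq_iff)
  then show "(\<lambda>i. v i - w i) \<in> E ` carrier G" using xy by auto
qed

end

text \<open>
  Enumerate the positive elements.  By the absorption lemma there is a sequence of independent positive
  families, each of which absorbs the preceding family and the next element of the enumeration.
  Every family spans a simplicial group inside \<open>G\<close>, the inclusions are given by matrices with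
  nonnegative entries, and \<open>G\<close> is the union.
\<close>

lemma ultrasimplicial_if_divisible_vectors:
  fixes G :: "('a, 'c) ordered_group_scheme" and E :: "'a \<Rightarrow> 'i \<Rightarrow> rat"
  assumes G: "comm_group G"
    and E_mult: "\<And>x y. x \<in> carrier G \<Longrightarrow> y \<in> carrier G \<Longrightarrow> E (x \<otimes>\<^bsub>G\<^esub> y) = (\<lambda>i. E x i + E y i)"
    and inj: "inj_on E (carrier G)"
    and I: "finite I" "\<And>x i. i \<notin> I \<Longrightarrow> E x i = 0"
    and divisible: "\<And>x M. x \<in> carrier G \<Longrightarrow> \<exists>N>M. (\<lambda>i. E x i / of_nat N) \<in> E ` carrier G"
    and pos: "pos_cone G = {x \<in> carrier G. E x l > 0} \<union> {\<one>\<^bsub>G\<^esub>}"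
    and u: "u \<in> carrier G" "E u l \<noteq> 0"
  shows "ultrasimplicial G"
proof -
  interpret G: comm_group G by fact
  define V where "V = E ` carrier G"
  note E1 = coordinates_one[OF G.group_axioms E_mult]
  note Einv = coordinates_inv[OF G.group_axioms E_mult]
  have V: "vector_group V"
    unfolding V_def by (rule vector_group_coordinates[OF G.group_axioms E_mult])
  have Vsupp: "\<forall>v\<in>V. \<forall>i. i \<notin> I \<longrightarrow> v i = 0" using I(2) by (auto simp: V_def)
  have Vdiv: "\<exists>N>M. (\<lambda>i. v i / of_nat N) \<in> V" if "v \<in> V" for v M
    using divisible that by (auto simp: V_def)

  have countable: "countable (carrier G)"
  proof -
    obtain idx where idx: "set idx = I" using I(1) finite_list by blast
    have "inj_on (\<lambda>x. map (E x) idx) (carrier G)"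
    proof (rule inj_onI)
      fix x y assume xy: "x \<in> carrier G" "y \<in> carrier G" "map (E x) idx = map (E y) idx"
      have "E x i = E y i" for i
        using xy(3) I(2)[of i] idx by (cases "i \<in> I") auto
      then show "x = y" using inj xy(1,2) by (auto simp: inj_on_def fun_eq_iff)
    qed
    then show ?thesis by (rule countable_image_inj_on[OF countableI_type])
  qed

  define P where "P = {v \<in> V. v l > 0}"
  have "\<exists>w\<in>V. w l > 0"
  proof (cases "E u l > 0")
    case True
    then show ?thesis using u(1) by (auto simp: V_def)
  next
    case False
    then have "E (inv\<^bsub>G\<^esub> u) l > 0" using u Einv by simp
    then show ?thesis using u(1) by (auto simp: V_def)
  qed
  then obtain w where w: "w \<in> V" "w l > 0" by blast
  then have "P \<noteq> {}" by (auto simp: P_def)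
  have "countable P"
    by (rule countable_subset[of _ V]) (use countable in \<open>auto simp: P_def V_def\<close>)
  define p where "p = from_nat_into P"
  have p: "range p = P" unfolding p_def using \<open>P \<noteq> {}\<close> \<open>countable P\<close> by (rule range_from_nat_into)

  \<comment> \<open>a family is coded as a pair of its length and its members\<close>
  define good where "good B \<longleftrightarrow> (\<forall>j<fst B. snd B j \<in> P) \<and> lattice_independent (fst B) (snd B)"
    for B :: "nat \<times> (nat \<Rightarrow> 'i \<Rightarrow> rat)"
  define absorbs where "absorbs B' v \<longleftrightarrow> (\<exists>c. (\<forall>j<fst B'. c j \<ge> 0) \<and> v = lincomb (fst B') c (snd B'))"
    for B' :: "nat \<times> (nat \<Rightarrow> 'i \<Rightarrow> rat)" and v
  have step: "\<exists>B'. good B' \<and> (absorbs B' (p n) \<and> (\<forall>j<fst B. absorbs B' (snd B j)))"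
    if B: "good B" for B n
  proof -
    let ?X = "insert (p n) (snd B ` {..<fst B})"
    have "?X \<subseteq> P" using p B by (auto simp: good_def)
    then have X: "?X \<subseteq> V" "\<And>x. x \<in> ?X \<Longrightarrow> x l > 0" by (auto simp: P_def)
    have "\<exists>m b. (\<forall>j<m. b j \<in> V \<and> b j l > 0) \<and> lattice_independent m b \<and>
        (\<forall>x\<in>?X. \<exists>c. (\<forall>j<m. c j \<ge> 0) \<and> x = lincomb m c b)"
      by (rule absorbing_cone[OF V I(1) Vsupp]) (erule Vdiv, simp, rule X(1), erule X(2))
    then obtain m b where "\<forall>j<m. b j \<in> V \<and> b j l > 0" "lattice_independent m b"
      "\<forall>x\<in>?X. \<exists>c. (\<forall>j<m. c j \<ge> 0) \<and> x = lincomb m c b"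
      by (elim exE conjE)
    then have "good (m, b)" "\<forall>x\<in>?X. absorbs (m, b) x"
      by (simp_all add: good_def P_def absorbs_def)
    then show ?thesis by (intro exI[of _ "(m, b)"]) simp
  qed
  have "good (0, \<lambda>_ _. 0)" by (simp add: good_def lattice_independent_def)
  then obtain B where B: "\<And>n. good (B n)"
    and Bp: "\<And>n. absorbs (B (Suc n)) (p n)"
    and BB: "\<And>n j. j < fst (B n) \<Longrightarrow> absorbs (B (Suc n)) (snd (B n) j)"
    using dependent_nat_choice[of "\<lambda>_. good"
        "\<lambda>n B B'. absorbs B' (p n) \<and> (\<forall>j<fst B. absorbs B' (snd B j))"] step
    by (metis (no_types, lifting))
  define m where "m n = fst (B n)" for n
  define b where "b n = snd (B n)" for n
  have bP: "b n j \<in> V" "b n j l > 0" if "j < m n" for n j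
    using B[of n] that by (auto simp: good_def P_def m_def b_def)
  have ind: "lattice_independent (m n) (b n)" for n
    using B[of n] by (simp add: good_def m_def b_def)
  define C where "C n j = (SOME c. (\<forall>i<m (Suc n). c i \<ge> 0) \<and>
    b n j = lincomb (m (Suc n)) c (b (Suc n)))" for n j
  have "(\<forall>i<m (Suc n). C n j i \<ge> 0) \<and> b n j = lincomb (m (Suc n)) (C n j) (b (Suc n))"
    if "j < m n" for n j
  proof -
    have "\<exists>c. (\<forall>i<m (Suc n). c i \<ge> 0) \<and> b n j = lincomb (m (Suc n)) c (b (Suc n))"
      using BB[of j n] that unfolding absorbs_def m_def b_def .
    then show ?thesis unfolding C_def by (rule someI_ex)
  qed
  then have C: "\<And>n j i. j < m n \<Longrightarrow> i < m (Suc n) \<Longrightarrow> C n j i \<ge> 0"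
    and bC: "\<And>n j. j < m n \<Longrightarrow> b n j = lincomb (m (Suc n)) (C n j) (b (Suc n))"
    by simp_all

  let ?A = "\<lambda>n. simplicial_group (m n)"
  define f where "f n x = (\<lambda>i\<in>{..<m (Suc n)}. \<Sum>j<m n. x j * C n j i)" for n x
  define \<phi> where "\<phi> n x = the_inv_into (carrier G) E (lincomb (m n) x (b n))" for n x
  have lcV: "lincomb (m n) x (b n) \<in> E ` carrier G" for n x
    using vector_group_lincomb[OF V bP(1)] by (simp add: V_def)
  have \<phi>: "\<phi> n x \<in> carrier G" "E (\<phi> n x) = lincomb (m n) x (b n)" for n x
    unfolding \<phi>_def using lcV inj
    by (auto intro: the_inv_into_into f_the_inv_into_f simp: f_the_inv_into_f)
  have \<phi>I: "\<phi> n x = g" if "g \<in> carrier G" "E g = lincomb (m n) x (b n)" for n x g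
    using that \<phi>[of n x] inj by (auto simp: inj_on_def)
  have lc_restrict: "lincomb k (restrict x {..<k}) a = lincomb k x a"
    for k x and a :: "nat \<Rightarrow> 'i \<Rightarrow> rat"
    by (simp add: lincomb_def)
  have \<phi>_hom: "\<phi> n \<in> hom (?A n) G" for n
  proof (rule homI)
    fix x y
    show "\<phi> n (x \<otimes>\<^bsub>?A n\<^esub> y) = \<phi> n x \<otimes>\<^bsub>G\<^esub> \<phi> n y"
      by (rule \<phi>I) (simp_all add: \<phi> E_mult fun_eq_iff simplicial_group_simps lc_restrict,
        simp add: lincomb_def distrib_right sum.distrib)
  qed (rule \<phi>)
  have \<phi>_inj: "inj_on (\<phi> n) (carrier (?A n))" for n
  proof (rule inj_onI)
    fix x y assume xy: "x \<in> carrier (?A n)" "y \<in> carrier (?A n)" "\<phi> n x = \<phi> n y"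
    then have "lincomb (m n) x (b n) = lincomb (m n) y (b n)" using \<phi>(2) by metis
    then have "x j = y j" if "j < m n" for j
      using lattice_independent_unique[OF ind] that by blast
    then show "x = y"
      using xy(1,2) by (intro PiE_ext[of x "{..<m n}" "\<lambda>_. UNIV"]) (auto simp: simplicial_group_simps)
  qed
  have \<phi>_f: "\<phi> (Suc n) (f n x) = \<phi> n x" for n x
  proof (rule \<phi>I[OF \<phi>(1)])
    have "lincomb (m n) x (b n) i = lincomb (m (Suc n)) (f n x) (b (Suc n)) i" for i
    proof -
      have "b n j i = (\<Sum>k<m (Suc n). of_int (C n j k) * b (Suc n) k i)" if "j < m n" for j
        by (subst bC[OF that]) (simp add: lincomb_def)
      then have "lincomb (m n) x (b n) i
          = (\<Sum>j<m n. of_int (x j) * (\<Sum>k<m (Suc n). of_int (C n j k) * b (Suc n) k i))"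
        unfolding lincomb_def by (intro sum.cong) simp_all
      also have "\<dots> = (\<Sum>k<m (Suc n). \<Sum>j<m n. of_int (x j * C n j k) * b (Suc n) k i)"
        unfolding sum_distrib_left by (subst sum.swap) (simp add: mult.assoc)
      also have "\<dots> = lincomb (m (Suc n)) (f n x) (b (Suc n)) i"
        unfolding f_def lc_restrict by (simp add: lincomb_def sum_distrib_right)
      finally show ?thesis .
    qed
    then show "E (\<phi> n x) = lincomb (m (Suc n)) (f n x) (b (Suc n))"
      unfolding \<phi> by (rule ext)
  qed
  have f_hom: "f n \<in> hom (?A n) (?A (Suc n))" for n
  proof (rule homI)
    show "f n x \<in> carrier (?A (Suc n))" for x by (simp add: f_def simplicial_group_simps)
    show "f n (x \<otimes>\<^bsub>?A n\<^esub> y) = f n x \<otimes>\<^bsub>?A (Suc n)\<^esub> f n y" for x y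
      unfolding f_def simplicial_group_simps
      by (rule restrict_ext) (simp add: distrib_right sum.distrib)
  qed
  have f_pos: "f n ` pos_cone (?A n) \<subseteq> pos_cone (?A (Suc n))" for n
  proof (rule image_subsetI)
    fix x assume "x \<in> pos_cone (?A n)"
    then have "0 \<le> (\<Sum>j<m n. x j * C n j i)" if "i < m (Suc n)" for i
      using C that by (intro sum_nonneg mult_nonneg_nonneg) (simp_all add: simplicial_group_simps)
    then show "f n x \<in> pos_cone (?A (Suc n))" by (simp add: f_def simplicial_group_simps)
  qed
  have f_inj: "inj_on (f n) (carrier (?A n))" for n
    using \<phi>_inj[of n] \<phi>_f[of n] unfolding inj_on_def by metis

  have pos_\<phi>: "\<phi> n x \<in> pos_cone G" if x: "x \<in> pos_cone (?A n)" for n x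
  proof (cases "\<forall>j<m n. x j = 0")
    case True
    then have "lincomb (m n) x (b n) = (\<lambda>_. 0)" by (simp add: lincomb_def)
    then have "\<phi> n x = \<one>\<^bsub>G\<^esub>" by (intro \<phi>I) (simp_all add: E1)
    then show ?thesis by (simp add: pos)
  next
    case False
    then obtain j where j: "j < m n" "x j \<noteq> 0" by blast
    have x0: "x i \<ge> 0" if "i < m n" for i using x that by (simp add: simplicial_group_simps)
    have "0 < (\<Sum>j<m n. of_int (x j) * b n j l)"
    proof (rule sum_pos2[of _ j])
      have "x j > 0" using x0[OF j(1)] j(2) by simp
      then show "0 < of_int (x j) * b n j l" using bP(2)[OF j(1)] by simp
      show "0 \<le> of_int (x i) * b n i l" if "i \<in> {..<m n}" for i
        using x0[of i] bP(2)[of i n] that by simp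
    qed (use j in auto)
    then have "E (\<phi> n x) l > 0" by (simp add: \<phi>(2) lincomb_def)
    then show ?thesis using \<phi>(1) by (simp add: pos)
  qed
  have cover_pos: "\<exists>n. \<exists>x\<in>pos_cone (?A n). \<phi> n x = g" if g: "g \<in> carrier G" "E g l > 0" for g
  proof -
    have "E g \<in> range p" using g unfolding p P_def V_def by auto
    then obtain n where "E g = p n" by auto
    with Bp[of n] obtain c where c: "\<forall>j<m (Suc n). c j \<ge> 0"
      "E g = lincomb (m (Suc n)) c (b (Suc n))"
      unfolding absorbs_def m_def b_def by auto
    have "restrict c {..<m (Suc n)} \<in> pos_cone (?A (Suc n))"
      using c(1) by (auto simp: simplicial_group_simps)
    moreover have "\<phi> (Suc n) (restrict c {..<m (Suc n)}) = g"
      using g(1) c(2) by (intro \<phi>I) (simp_all add: lc_restrict)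
    ultimately show ?thesis by blast
  qed
  have sub: "pos_cone (?A n) \<subseteq> carrier (?A n)" for n by (auto simp: simplicial_group_simps)
  have cover: "\<exists>n. \<exists>x\<in>carrier (?A n). \<phi> n x = g" if g: "g \<in> carrier G" for g
  proof -
    \<comment> \<open>\<open>g\<close> is the difference of the positive elements \<open>g + h\<close> and \<open>h\<close>, for a large multiple \<open>h\<close> of \<open>w\<close>\<close>
    obtain k0 :: nat where "- E g l / w l < of_nat k0" using reals_Archimedean2 by blast
    then obtain k :: nat where k: "- E g l / w l < of_nat k" "0 < k"
      using that[of "Suc k0"] by simp
    have "(\<lambda>i. of_int (int k) * w i) \<in> V" by (rule vector_group_mult[OF V w(1)])
    then obtain h where h: "h \<in> carrier G" "E h = (\<lambda>i. of_nat k * w i)" by (auto simp: V_def)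
    have "E h l > 0" using h(2) k(2) w(2) by simp
    then obtain j y where y: "y \<in> pos_cone (?A j)" "\<phi> j y = h" using cover_pos h(1) by blast
    have "E (g \<otimes>\<^bsub>G\<^esub> h) l > 0" using k(1) w(2) g h by (simp add: E_mult field_simps)
    then obtain i x where x: "x \<in> pos_cone (?A i)" "\<phi> i x = g \<otimes>\<^bsub>G\<^esub> h"
      using cover_pos[of "g \<otimes>\<^bsub>G\<^esub> h"] g h(1) by auto
    let ?n = "max i j"
    note tr = transition_commutes[of f ?A \<phi>, OF f_hom \<phi>_f]
    obtain x' where x': "x' \<in> carrier (?A ?n)" "\<phi> ?n x' = g \<otimes>\<^bsub>G\<^esub> h"
      using tr[of i ?n x] x sub by fastforce
    obtain y' where y': "y' \<in> carrier (?A ?n)" "\<phi> ?n y' = h"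
      using tr[of j ?n y] y sub by fastforce
    interpret \<phi>: group_hom "?A ?n" G "\<phi> ?n"
      by (intro group_hom.intro group_simplicial_group G.group_axioms group_hom_axioms.intro \<phi>_hom)
    have "\<phi> ?n (x' \<otimes>\<^bsub>?A ?n\<^esub> inv\<^bsub>?A ?n\<^esub> y') = g"
      using x' y' g h(1) by (simp add: G.m_assoc)
    then show ?thesis using x'(1) y'(1) by (metis \<phi>.G.inv_closed \<phi>.G.m_closed)
  qed
  have "ordered_isomorphic G (inductive_limit ?A f)"
  proof (rule ordered_isomorphic_inductive_limit)
    show "carrier G = (\<Union>n. \<phi> n ` carrier (?A n))" using cover \<phi>(1) by blast
    have "\<phi> 0 (\<lambda>_\<in>{..<m 0}. 0) = \<one>\<^bsub>G\<^esub>"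
      by (intro \<phi>I) (simp_all add: E1, simp add: lincomb_def)
    moreover have "(\<lambda>_\<in>{..<m 0}. 0) \<in> pos_cone (?A 0)" by (simp add: simplicial_group_simps)
    ultimately have one: "\<exists>n. \<exists>x\<in>pos_cone (?A n). \<phi> n x = \<one>\<^bsub>G\<^esub>" by blast
    show "pos_cone G = (\<Union>n. \<phi> n ` pos_cone (?A n))"
    proof (intro equalityI subsetI)
      fix g assume "g \<in> pos_cone G"
      then have "g = \<one>\<^bsub>G\<^esub> \<or> g \<in> carrier G \<and> E g l > 0" by (auto simp: pos)
      then have "\<exists>n. \<exists>x\<in>pos_cone (?A n). \<phi> n x = g" using one cover_pos by blast
      then show "g \<in> (\<Union>n. \<phi> n ` pos_cone (?A n))" by blast
    next
      fix g assume "g \<in> (\<Union>n. \<phi> n ` pos_cone (?A n))"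
      then show "g \<in> pos_cone G" using pos_\<phi> by blast
    qed
  qed (rule group_simplicial_group G.group_axioms f_hom \<phi>_hom \<phi>_inj \<phi>_f sub)+
  moreover have "simplicial_sequence m f"
    using f_hom f_pos by (simp add: simplicial_sequence_def positive_hom_def)
  moreover have "ordered_abelian_group G"
    unfolding ordered_abelian_group_def
  proof (intro conjI ballI impI G)
    show "pos_cone G \<subseteq> carrier G" "\<one>\<^bsub>G\<^esub> \<in> pos_cone G" by (auto simp: pos)
    show "x \<otimes>\<^bsub>G\<^esub> y \<in> pos_cone G" if "x \<in> pos_cone G" "y \<in> pos_cone G" for x y
      using that by (auto simp: pos E_mult)
    show "x = \<one>\<^bsub>G\<^esub>" if "x \<in> pos_cone G" "inv\<^bsub>G\<^esub> x \<in> pos_cone G" for x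
      using that Einv[of x l] E1 by (auto simp: pos)
  qed
  ultimately show ?thesis using countable f_inj by (intro ultrasimplicialI)
qed


section \<open>Rational coordinates of a group of finite rank\<close>

lemma int_independentD:
  "int_independent A S \<Longrightarrow> finite T \<Longrightarrow> T \<subseteq> S \<Longrightarrow>
    (\<Otimes>\<^bsub>A\<^esub>x\<in>T. x [^]\<^bsub>A\<^esub> (c x :: int)) = \<one>\<^bsub>A\<^esub> \<Longrightarrow> x \<in> T \<Longrightarrow> c x = 0"
  unfolding int_independent_def by (elim conjE allE[of _ T] allE[of _ c] impE) auto

text \<open>
  By maximality of \<open>S\<close>, every \<open>k\<close> has a nonzero multiple \<open>d k = \<Sum> a\<^sub>s s\<close>; independence makes the
  ratios \<open>a\<^sub>s / d\<close> depend only on \<open>k\<close>, and torsion-freeness makes them determine \<open>k\<close>.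
\<close>

lemma rational_coordinates:
  fixes K (structure)
  assumes "comm_group K" and tf: "torsion_free K" and max: "maximal_int_independent K S"
    and fin: "finite S"
  obtains \<kappa> :: "'k \<Rightarrow> 'k \<Rightarrow> rat" where
    "\<And>k l s. k \<in> carrier K \<Longrightarrow> l \<in> carrier K \<Longrightarrow> \<kappa> (k \<otimes> l) s = \<kappa> k s + \<kappa> l s"
    "inj_on \<kappa> (carrier K)"
    "\<And>k s. s \<notin> S \<Longrightarrow> \<kappa> k s = 0"
    "\<And>s t. s \<in> S \<Longrightarrow> \<kappa> s t = (if t = s then 1 else 0)"
proof -
  interpret comm_group K by fact
  have ind: "int_independent K S" and maxD: "\<And>T. int_independent K T \<Longrightarrow> S \<subseteq> T \<Longrightarrow> T = S"
    using max by (auto simp: maximal_int_independent_def)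
  have S: "S \<subseteq> carrier K" using ind by (simp add: int_independent_def)
  define lc where "lc a = (\<Otimes>s\<in>S. s [^] (a s :: int))" for a
  have lc_closed [simp]: "lc a \<in> carrier K" for a
    unfolding lc_def using S by (intro finprod_closed) auto
  have lc_add: "lc (\<lambda>s. a s + b s) = lc a \<otimes> lc b" for a b
  proof -
    have "lc (\<lambda>s. a s + b s) = (\<Otimes>s\<in>S. s [^] a s \<otimes> s [^] b s)"
      unfolding lc_def using S by (intro finprod_cong) (auto simp: int_pow_mult simp_implies_def)
    also have "\<dots> = lc a \<otimes> lc b"
      unfolding lc_def using S by (intro finprod_multf) auto
    finally show ?thesis .
  qed
  have lc_0: "lc a = \<one>" if "\<And>s. s \<in> S \<Longrightarrow> a s = 0" for a
  proof -
    have "lc a = (\<Otimes>s\<in>S. \<one>)"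
      unfolding lc_def using that by (intro finprod_cong) (auto simp: simp_implies_def)
    then show ?thesis by simp
  qed
  have lc_neg: "lc (\<lambda>s. - a s) = inv (lc a)" for a
  proof -
    have "lc a \<otimes> lc (\<lambda>s. - a s) = \<one>" using lc_add[of a "\<lambda>s. - a s"] lc_0 by simp
    then have "lc (\<lambda>s. - a s) \<otimes> lc a = \<one>" by (simp add: m_comm)
    then show ?thesis by (intro inv_equality[symmetric]) simp_all
  qed
  have lc_pow: "lc (\<lambda>s. n * a s) = lc a [^] n" for n :: int and a
  proof (induction n rule: int_induct[of _ 0])
    case base
    then show ?case by (simp add: lc_0)
  next
    case (step1 n)
    then show ?case using lc_add[of "\<lambda>s. n * a s" a] by (simp add: distrib_right int_pow_mult)
  next
    case (step2 n)
    then show ?case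
      using lc_add[of "\<lambda>s. n * a s" "\<lambda>s. - a s"]
      by (simp add: left_diff_distrib int_pow_diff lc_neg)
  qed
  have lc_zero: "a s = 0" if "lc a = \<one>" "s \<in> S" for a s
    using int_independentD[OF ind fin subset_refl _ that(2)] that(1) unfolding lc_def by simp
  have lc_inj: "a s = b s" if "lc a = lc b" "s \<in> S" for a b s
  proof -
    have "lc (\<lambda>s. a s + - b s) = \<one>" using that(1) unfolding lc_add lc_neg by simp
    from lc_zero[OF this that(2)] show ?thesis by simp
  qed
  have lc_unit: "lc (\<lambda>t. if t = s then 1 else 0) = s" if "s \<in> S" for s
  proof -
    have "lc (\<lambda>t. if t = s then 1 else 0) = (\<Otimes>t\<in>S. if t = s then t else \<one>)"
      unfolding lc_def using S that by (intro finprod_cong) (auto simp: simp_implies_def)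
    also have "\<dots> = s"
      using finprod_singleton_swap[OF that fin, of "\<lambda>t. t"] S by auto
    finally show ?thesis .
  qed
  have "\<exists>(d::int) a. d \<noteq> 0 \<and> k [^] d = lc a" if k: "k \<in> carrier K" for k
  proof (cases "k \<in> S")
    case True
    then have "k [^] (1::int) = lc (\<lambda>t. if t = k then 1 else 0)" using lc_unit k by simp
    then show ?thesis by (intro exI[of _ "1::int"] exI[of _ "\<lambda>t. if t = k then 1 else 0"]) simp
  next
    case False
    then have "\<not> int_independent K (insert k S)" using maxD by blast
    then obtain T c where T: "finite T" "T \<subseteq> insert k S" and
      rel: "(\<Otimes>x\<in>T. x [^] (c x :: int)) = \<one>" and ne: "\<exists>x\<in>T. c x \<noteq> 0"
      using S k by (auto simp: int_independent_def)
    have "k \<in> T"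
    proof (rule ccontr)
      assume "k \<notin> T"
      then have "T \<subseteq> S" using T by blast
      then show False using int_independentD[OF ind T(1) _ rel] ne by blast
    qed
    define U where "U = T - {k}"
    have U: "T = insert k U" "k \<notin> U" "U \<subseteq> S" "finite U" using T \<open>k \<in> T\<close> by (auto simp: U_def)
    have UK: "(\<lambda>x. x [^] c x) \<in> U \<rightarrow> carrier K" using U(3) S by auto
    have lcU: "lc (\<lambda>s. if s \<in> U then c s else 0) = (\<Otimes>x\<in>U. x [^] c x)"
      unfolding lc_def using U(3) S fin
      by (intro finprod_mono_neutral_cong_left[symmetric]) auto
    have r: "k [^] c k \<otimes> (\<Otimes>x\<in>U. x [^] c x) = \<one>"
      using rel k UK U(2,4) unfolding U(1) by (simp add: finprod_insert)
    have "c k \<noteq> 0"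
    proof
      assume "c k = 0"
      then have "(\<Otimes>x\<in>U. x [^] c x) = \<one>" using r UK by simp
      moreover have "\<exists>x\<in>U. c x \<noteq> 0" using ne \<open>c k = 0\<close> unfolding U(1) by auto
      ultimately show False using int_independentD[OF ind U(4,3)] by blast
    qed
    moreover have "k [^] c k = lc (\<lambda>s. - (if s \<in> U then c s else 0))"
      using r k UK unfolding lc_neg lcU by (simp add: inv_equality)
    ultimately show ?thesis by blast
  qed
  then obtain d a where d: "\<And>k. k \<in> carrier K \<Longrightarrow> d k \<noteq> (0::int)"
    and a: "\<And>k. k \<in> carrier K \<Longrightarrow> k [^] d k = lc (a k)" by metis
  define \<kappa> where
    "\<kappa> k s = (if s \<in> S \<and> k \<in> carrier K then rat_of_int (a k s) / of_int (d k) else 0)" for k s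
  have \<kappa>: "\<kappa> k s = of_int (b s) / of_int e"
    if k: "k \<in> carrier K" and e: "e \<noteq> 0" "k [^] e = lc b" and s: "s \<in> S" for k e b s
  proof -
    have "lc (\<lambda>s. e * a k s) = lc (\<lambda>s. d k * b s)"
      unfolding lc_pow a[OF k, symmetric] e(2)[symmetric] using k
      by (simp add: int_pow_pow mult.commute)
    from lc_inj[OF this s] have "rat_of_int e * of_int (a k s) = of_int (d k) * of_int (b s)"
      by (metis of_int_mult)
    then show ?thesis using s k e(1) d[OF k] by (simp add: \<kappa>_def field_simps)
  qed
  have hom: "\<kappa> (k \<otimes> l) s = \<kappa> k s + \<kappa> l s" if k: "k \<in> carrier K" and l: "l \<in> carrier K" for k l s
  proof (cases "s \<in> S")
    case True
    have "(k \<otimes> l) [^] (d k * d l) = (k [^] d k) [^] d l \<otimes> (l [^] d l) [^] d k"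
      using k l by (simp add: int_pow_distrib int_pow_pow mult.commute)
    also have "\<dots> = lc (\<lambda>s. d l * a k s + d k * a l s)"
      unfolding lc_add lc_pow a[OF k] a[OF l] ..
    finally have "\<kappa> (k \<otimes> l) s = of_int (d l * a k s + d k * a l s) / of_int (d k * d l)"
      using \<kappa>[of "k \<otimes> l" "d k * d l" _ s] k l d True by simp
    then show ?thesis using k l d True by (simp add: \<kappa>_def field_simps)
  qed (simp add: \<kappa>_def)
  have kernel: "k = \<one>" if k: "k \<in> carrier K" and z: "\<And>s. \<kappa> k s = 0" for k
  proof -
    have "a k s = 0" if "s \<in> S" for s using z[of s] that k d by (simp add: \<kappa>_def)
    then have p: "k [^] d k = \<one>" using a[OF k] lc_0 by simp
    have "k [^] nat \<bar>d k\<bar> = \<one>"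
    proof (cases "d k \<ge> 0")
      case True
      then show ?thesis using p by (simp flip: int_pow_int)
    next
      case False
      moreover have "k [^] (- d k) = \<one>" using p k by (simp add: int_pow_neg)
      ultimately show ?thesis by (simp flip: int_pow_int)
    qed
    moreover have "nat \<bar>d k\<bar> > 0" using d[OF k] by simp
    ultimately show "k = \<one>" using tf k unfolding torsion_free_def by blast
  qed
  show ?thesis
  proof
    show "inj_on \<kappa> (carrier K)"
    proof (rule inj_onI)
      fix k l assume k: "k \<in> carrier K" and l: "l \<in> carrier K" and eq: "\<kappa> k = \<kappa> l"
      have "\<kappa> (k \<otimes> inv l) s = 0" for s
        using hom[of k "inv l" s] hom[of l "inv l" s] hom[of \<one> \<one> s] k l eq by simp
      then have "k \<otimes> inv l = \<one>" using k l by (intro kernel) auto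
      then show "k = l" using k l by (metis inv_closed inv_equality inv_inv)
    qed
  next
    fix s t assume s: "s \<in> S"
    show "\<kappa> s t = (if t = s then 1 else 0)"
    proof (cases "t \<in> S")
      case True
      then show ?thesis
        using \<kappa>[of s 1 "\<lambda>t. if t = s then 1 else 0" t] lc_unit[OF s] s S by auto
    qed (use s in \<open>auto simp: \<kappa>_def\<close>)
  qed (simp_all add: hom, simp add: \<kappa>_def)
qed

section \<open>Types and divisibility\<close>

lemma height_le_imp_power:
  assumes "group A" "x \<in> carrier A" "enat n \<le> height A x q"
  shows "x \<in> power_subset A (nat_of_prime q ^ n)"
proof -
  interpret group A by fact
  define p where "p = nat_of_prime q"
  define P where "P m \<longleftrightarrow> x \<in> power_subset A (p ^ m) - power_subset A (p ^ (m + 1))" for m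
  have mono: "x \<in> power_subset A (p ^ i)" if j: "x \<in> power_subset A (p ^ j)" and "i \<le> j" for i j
  proof -
    obtain y where y: "y \<in> carrier A" "x = y [^]\<^bsub>A\<^esub> (p ^ j)"
      using j by (auto simp: power_subset_def)
    have "p ^ j = p ^ (j - i) * p ^ i" using \<open>i \<le> j\<close> by (simp flip: power_add)
    then have "x = (y [^]\<^bsub>A\<^esub> (p ^ (j - i))) [^]\<^bsub>A\<^esub> (p ^ i)" using y by (simp add: nat_pow_pow)
    then show ?thesis using y(1) by (auto simp: power_subset_def)
  qed
  have h: "height A x q = (if \<exists>m. P m then enat (THE m. P m) else \<infinity>)"
    unfolding height_def P_def p_def Let_def by (rule refl)
  have "x \<in> power_subset A (p ^ n)"
  proof (cases "\<exists>m. P m")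
    case True
    then obtain m where m: "P m" by blast
    have "(THE m. P m) = m"
    proof (rule the_equality[where P = P, OF m])
      fix j assume "P j"
      then have "\<not> j + 1 \<le> m" "\<not> m + 1 \<le> j"
        using m mono[of m "j + 1"] mono[of j "m + 1"] unfolding P_def by auto
      then show "j = m" by simp
    qed
    then have "n \<le> m" using True h assms(3) by simp
    then show ?thesis using m mono[of m n] by (simp add: P_def)
  next
    case False
    show ?thesis
    proof (induction n)
      case 0
      then show ?case using assms(2) by (auto simp: power_subset_def intro!: image_eqI[of _ _ x])
    next
      case (Suc n)
      then show ?case using False by (simp add: P_def)
    qed
  qed
  then show ?thesis by (simp add: p_def)
qed

lemma finite_primes_le: "finite {q. nat_of_prime q \<le> B}"
proof (rule finite_imageD)
  show "inj_on nat_of_prime {q. nat_of_prime q \<le> B}"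
    by (simp add: inj_on_def nat_of_prime_inject)
  show "finite (nat_of_prime ` {q. nat_of_prime q \<le> B})"
    by (rule finite_subset[of _ "{..B}"]) auto
qed

lemma one_less_nat_of_prime: "1 < nat_of_prime q"
  using nat_of_prime[of q] by (simp add: prime_gt_Suc_0_nat)

text \<open>
  Contrapositively, a height sequence outside the type of the integers has an infinite entry or infinitely many
  nonzero entries; either way it allows arbitrarily large prime powers as divisors.
\<close>

lemma bounded_height_equiv_0:
  assumes "\<And>q n. enat n \<le> \<alpha> q \<Longrightarrow> nat_of_prime q ^ n \<le> B"
  shows "height_equiv \<alpha> (\<lambda>_. 0)"
proof -
  have "\<alpha> q \<noteq> \<infinity>" for q
  proof
    assume "\<alpha> q = \<infinity>"
    then have "nat_of_prime q ^ B \<le> B" using assms[of B q] by simp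
    moreover have "B < nat_of_prime q ^ B"
      using one_less_nat_of_prime[of q] by (simp add: power_gt_expt)
    ultimately show False by simp
  qed
  moreover have "{q. \<alpha> q \<noteq> 0} \<subseteq> {q. nat_of_prime q \<le> B}"
  proof safe
    fix q assume "\<alpha> q \<noteq> 0"
    then have "enat 1 \<le> \<alpha> q" by (metis ileI1 one_eSuc one_enat_def zero_less_iff_neq_zero)
    then show "nat_of_prime q \<le> B" using assms[of 1 q] by simp
  qed
  then have "finite {q. \<alpha> q \<noteq> 0}" using finite_primes_le finite_subset by blast
  ultimately show ?thesis by (simp add: height_equiv_def)
qed

lemma rank_one_type_integers: "rank_one_type integer_group = abs_baer_type (\<lambda>_. 0)"
proof -
  define z :: int where "z = (SOME a. a \<in> carrier integer_group - {\<one>\<^bsub>integer_group\<^esub>})"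
  have "1 \<in> carrier integer_group - {\<one>\<^bsub>integer_group\<^esub>}" by (simp add: integer_group_def)
  then have "z \<in> carrier integer_group - {\<one>\<^bsub>integer_group\<^esub>}" unfolding z_def by (rule someI)
  then have z: "z \<noteq> 0" by (simp add: integer_group_def)
  have "nat_of_prime q ^ n \<le> nat \<bar>z\<bar>" if "enat n \<le> height integer_group z q" for q n
  proof -
    have "z \<in> power_subset integer_group (nat_of_prime q ^ n)"
      using height_le_imp_power[OF group_integer_group _ that] by simp
    then have "int (nat_of_prime q ^ n) dvd z"
      by (auto simp: power_subset_def)
    then have "int (nat_of_prime q ^ n) \<le> \<bar>z\<bar>" using dvd_imp_le_int[OF z] by fastforce
    then show ?thesis by linarith
  qed
  then have "height_equiv (height integer_group z) (\<lambda>_. 0)" by (rule bounded_height_equiv_0)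
  then have "abs_baer_type (height integer_group z) = abs_baer_type (\<lambda>_. 0)"
    by (simp add: baer_type.abs_eq_iff)
  then show ?thesis by (simp add: rank_one_type_def element_type_def z_def)
qed

lemma Inf_fin_element_type:
  assumes "finite S" "S \<noteq> {}"
  shows "\<exists>\<alpha>. Inf_fin (element_type A ` S) = abs_baer_type \<alpha> \<and> (\<forall>s\<in>S. \<alpha> \<le> height A s)"
  using assms
proof (induction S rule: finite_ne_induct)
  case (singleton s)
  then show ?case by (auto simp: element_type_def)
next
  case (insert s S)
  then obtain \<alpha> where \<alpha>: "Inf_fin (element_type A ` S) = abs_baer_type \<alpha>" "\<forall>s\<in>S. \<alpha> \<le> height A s"
    by blast
  have "Inf_fin (element_type A ` insert s S) = abs_baer_type (inf (height A s) \<alpha>)"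
    using insert.hyps \<alpha>(1) by (simp add: element_type_def inf_baer_type.abs_eq)
  moreover have "\<forall>t\<in>insert s S. inf (height A s) \<alpha> \<le> height A t"
    using \<alpha>(2) by (auto intro: le_infI2)
  ultimately show ?case by blast
qed

text \<open>
  The meet of the types of finitely many elements is represented by a sequence below all their
  heights, so the prime powers that it allows divide all the elements at once.
\<close>

lemma unbounded_common_divisors:
  assumes "group K" "group H" "finite S" "S \<noteq> {}" "S \<subseteq> carrier K" "h \<in> carrier H"
    and ne: "inf (Inf_fin (element_type K ` S)) (element_type H h) \<noteq> rank_one_type integer_group"
  shows "\<exists>Q>B. h \<in> power_subset H Q \<and> S \<subseteq> power_subset K Q"
proof -
  obtain \<alpha> where \<alpha>: "Inf_fin (element_type K ` S) = abs_baer_type \<alpha>" "\<forall>s\<in>S. \<alpha> \<le> height K s"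
    using Inf_fin_element_type[OF assms(3,4)] by blast
  define \<beta> where "\<beta> = inf \<alpha> (height H h)"
  have "abs_baer_type \<beta> \<noteq> abs_baer_type (\<lambda>_. 0)"
    using ne unfolding rank_one_type_integers \<alpha> element_type_def \<beta>_def by (simp add: inf_baer_type.abs_eq)
  then have "\<not> height_equiv \<beta> (\<lambda>_. 0)" by (simp add: baer_type.abs_eq_iff)
  then obtain q n where qn: "enat n \<le> \<beta> q" "B < nat_of_prime q ^ n"
    using bounded_height_equiv_0[of \<beta> B] by (meson linorder_not_le)
  have "enat n \<le> height H h q" using qn(1) by (simp add: \<beta>_def)
  then have "h \<in> power_subset H (nat_of_prime q ^ n)" by (rule height_le_imp_power[OF assms(2,6)])
  moreover have "S \<subseteq> power_subset K (nat_of_prime q ^ n)"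
  proof
    fix s assume s: "s \<in> S"
    have "enat n \<le> \<alpha> q" using qn(1) by (simp add: \<beta>_def)
    also have "\<alpha> q \<le> height K s q" using \<alpha>(2) s by (simp add: le_fun_def)
    finally show "s \<in> power_subset K (nat_of_prime q ^ n)"
      using height_le_imp_power[OF assms(1)] assms(5) s by blast
  qed
  ultimately show ?thesis using qn(2) by blast
qed

section \<open>The direct sum\<close>

text \<open>
  Bezout's identity for \<open>d\<close> and \<open>Q\<close> turns divisibility of \<open>d x\<close> by \<open>Q\<close> into divisibility of \<open>x\<close> by
  \<open>Q / gcd d Q\<close>, which is at least \<open>Q / d\<close>.
\<close>

lemma bezout_divisible:
  fixes V :: "('i \<Rightarrow> rat) set" and d Q :: nat
  assumes V: "vector_group V" and x: "x \<in> V" and "d > 0" "Q > 0"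
    and dx: "(\<lambda>i. of_nat d * x i / of_nat Q) \<in> V"
  shows "\<exists>N. Q \<le> N * d \<and> (\<lambda>i. x i / of_nat N) \<in> V"
proof -
  define g where "g = gcd d Q"
  define N where "N = Q div g"
  have g: "g > 0" "g \<le> d" "N * g = Q" using \<open>d > 0\<close> by (auto simp: g_def N_def gcd_le1_nat)
  obtain u v where uv: "u * int d + v * int Q = int g"
    using bezout_int[of "int d" "int Q"] by (auto simp: g_def)
  have "x i / of_nat N = of_int u * (of_nat d * x i / of_nat Q) + of_int v * x i" for i
  proof -
    have "rat_of_int u * of_nat d + of_int v * of_nat Q = of_nat g"
      using arg_cong[OF uv, of rat_of_int] by simp
    then have "of_int u * (of_nat d * x i) + of_int v * (of_nat Q * x i) = of_nat g * x i"
      by (metis distrib_right mult.assoc)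
    moreover have "x i / of_nat N = of_nat g * x i / of_nat Q"
      using g by (auto simp flip: g(3))
    ultimately show ?thesis using \<open>Q > 0\<close> by (simp add: field_simps)
  qed
  then have "(\<lambda>i. x i / of_nat N) \<in> V"
    using vector_group_add[OF V vector_group_mult[OF V dx] vector_group_mult[OF V x]] by presburger
  moreover have "Q \<le> N * d" using g by (metis mult_le_mono2)
  ultimately show ?thesis by blast
qed

lemma with_cone_simps [simp]:
  "carrier (with_cone G P) = carrier G"
  "x \<otimes>\<^bsub>with_cone G P\<^esub> y = x \<otimes>\<^bsub>G\<^esub> y"
  "\<one>\<^bsub>with_cone G P\<^esub> = \<one>\<^bsub>G\<^esub>"
  "pos_cone (with_cone G P) = P"
  by (simp_all add: with_cone_def)

text \<open>
  The coordinate \<open>None\<close> carries the embedding of \<open>H\<close>, the coordinate \<open>Some s\<close> that of \<open>K\<close> along \<open>s\<close>.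
  Unbounded common divisors of \<open>h0\<close> and of the members of \<open>S\<close> suffice for the divisibility of all
  vectors, because every vector has a multiple \<open>d x\<close> that is an integer combination of these.
\<close>

lemma direct_sum_ultrasimplicial:
  fixes H :: "('h, 'm) monoid_scheme" and K :: "('k, 'n) monoid_scheme" and \<iota> :: "'h \<Rightarrow> rat"
  assumes "comm_group H" "comm_group K" and \<iota>: "\<iota> \<in> mon H rat_group"
    and h0: "h0 \<in> carrier H" "h0 \<noteq> \<one>\<^bsub>H\<^esub>"
    and tf: "torsion_free K" and max: "maximal_int_independent K S" and fin: "finite S"
    and divisors: "\<And>B. \<exists>Q>B. h0 \<in> power_subset H Q \<and> S \<subseteq> power_subset K Q"
  shows "ultrasimplicial
           (with_cone (H \<times>\<times> K)
              ({(h, k). h \<in> carrier H \<and> k \<in> carrier K \<and> \<iota> h > 0} \<union> {\<one>\<^bsub>H \<times>\<times> K\<^esub>}))"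
    (is "ultrasimplicial ?G")
proof -
  interpret H: comm_group H by fact
  interpret K: comm_group K by fact
  have \<iota>_add: "\<iota> (h \<otimes>\<^bsub>H\<^esub> h') = \<iota> h + \<iota> h'" if "h \<in> carrier H" "h' \<in> carrier H" for h h'
    using \<iota> that by (simp add: mon_def hom_def rat_group_def)
  have \<iota>_1: "\<iota> \<one>\<^bsub>H\<^esub> = 0" using \<iota>_add[of "\<one>\<^bsub>H\<^esub>" "\<one>\<^bsub>H\<^esub>"] by simp
  have \<iota>_pow: "\<iota> (h [^]\<^bsub>H\<^esub> n) = of_nat n * \<iota> h" if "h \<in> carrier H" for h and n :: nat
    using that by (induction n) (simp_all add: \<iota>_1 \<iota>_add algebra_simps)
  have \<iota>_inj: "inj_on \<iota> (carrier H)" using \<iota> by (simp add: mon_def)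
  then have \<iota>_h0: "\<iota> h0 \<noteq> 0" using h0 \<iota>_1 by (metis H.one_closed inj_onD)
  obtain \<kappa> :: "'k \<Rightarrow> 'k \<Rightarrow> rat" where
    \<kappa>_add: "\<And>k l s. k \<in> carrier K \<Longrightarrow> l \<in> carrier K \<Longrightarrow> \<kappa> (k \<otimes>\<^bsub>K\<^esub> l) s = \<kappa> k s + \<kappa> l s" and
    \<kappa>_inj: "inj_on \<kappa> (carrier K)" and
    \<kappa>_supp: "\<And>k s. s \<notin> S \<Longrightarrow> \<kappa> k s = 0" and
    \<kappa>_unit: "\<And>s t. s \<in> S \<Longrightarrow> \<kappa> s t = (if t = s then 1 else 0)"
    by (rule rational_coordinates[OF assms(2) tf max fin]) (rule that)
  have \<kappa>_1: "\<kappa> \<one>\<^bsub>K\<^esub> s = 0" for s using \<kappa>_add[of "\<one>\<^bsub>K\<^esub>" "\<one>\<^bsub>K\<^esub>" s] by simp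
  have \<kappa>_pow: "\<kappa> (k [^]\<^bsub>K\<^esub> n) s = of_nat n * \<kappa> k s" if "k \<in> carrier K" for k s and n :: nat
    using that by (induction n) (simp_all add: \<kappa>_1 \<kappa>_add algebra_simps)

  define E where "E = (\<lambda>(h, k). case_option (\<iota> h) (\<kappa> k))"
  have E_simps [simp]: "E (h, k) None = \<iota> h" "E (h, k) (Some s) = \<kappa> k s" for h k s
    by (simp_all add: E_def)
  define I where "I = insert None (Some ` S)"
  have G: "comm_group ?G"
  proof -
    have "\<exists>y\<in>carrier ?G. y \<otimes>\<^bsub>?G\<^esub> x = \<one>\<^bsub>?G\<^esub>" if "x \<in> carrier ?G" for x
      using that by (intro bexI[of _ "(inv\<^bsub>H\<^esub> fst x, inv\<^bsub>K\<^esub> snd x)"]) auto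
    then show ?thesis
      by (intro comm_groupI)
        (auto simp: H.m_ac K.m_ac)
  qed
  have E_mult: "E (x \<otimes>\<^bsub>?G\<^esub> y) = (\<lambda>i. E x i + E y i)"
    if "x \<in> carrier ?G" "y \<in> carrier ?G" for x y
  proof
    show "E (x \<otimes>\<^bsub>?G\<^esub> y) i = E x i + E y i" for i
      using that by (cases x; cases y; cases i) (simp_all add: \<iota>_add \<kappa>_add)
  qed
  have E_supp: "E x i = 0" if "i \<notin> I" for x i
    using that by (cases x; cases i) (auto simp: I_def intro!: \<kappa>_supp)
  have E_inj: "inj_on E (carrier ?G)"
  proof (rule inj_onI)
    fix x y assume xy: "x \<in> carrier ?G" "y \<in> carrier ?G" "E x = E y"
    obtain h k h' k' where hk: "x = (h, k)" "y = (h', k')" by (cases x; cases y)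
    have "\<iota> h = \<iota> h'" using fun_cong[OF xy(3), of None] by (simp add: hk)
    moreover have "\<kappa> k = \<kappa> k'" using fun_cong[OF xy(3), of "Some s" for s] by (simp add: hk fun_eq_iff)
    ultimately show "x = y" using xy(1,2) \<iota>_inj \<kappa>_inj by (auto simp: hk inj_on_def)
  qed
  interpret G: comm_group ?G by (rule G)
  have V: "vector_group (E ` carrier ?G)"
    by (rule vector_group_coordinates[OF G.group_axioms E_mult])

  \<comment> \<open>the vector of \<open>h0\<close> or of \<open>s \<in> S\<close> is \<open>unit i\<close> in its own coordinate \<open>i\<close> and \<open>0\<close> elsewhere\<close>
  define unit where "unit i = (case i of None \<Rightarrow> \<iota> h0 | Some s \<Rightarrow> 1)" for i :: "'k option"
  have unit: "unit i \<noteq> 0" for i using \<iota>_h0 by (simp add: unit_def split: option.split)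
  have divisible: "\<exists>N>M. (\<lambda>i. E x i / of_nat N) \<in> E ` carrier ?G" if x: "x \<in> carrier ?G" for x M
  proof -
    have "finite I" using fin by (simp add: I_def)
    then have "finite ((\<lambda>i. E x i / unit i) ` I)" by (rule finite_imageI)
    then obtain d :: nat where "d > 0"
      and "\<And>q. q \<in> (\<lambda>i. E x i / unit i) ` I \<Longrightarrow> of_nat d * q \<in> \<int>"
      by (rule common_denominator) (rule that)
    then have d: "d > 0" "\<And>i. i \<in> I \<Longrightarrow> of_nat d * (E x i / unit i) \<in> \<int>" by blast+
    define c where "c i = \<lfloor>of_nat d * (E x i / unit i)\<rfloor>" for i
    have c: "of_nat d * E x i = of_int (c i) * unit i" if "i \<in> I" for i
    proof -
      have "of_int (c i) = of_nat d * (E x i / unit i)" unfolding c_def using d(2)[OF that] by simp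
      then show ?thesis using unit[of i] by simp
    qed
    \<comment> \<open>the factor \<open>d\<close> makes up for what Bezout's identity loses\<close>
    obtain Q where Q: "Q > M * d" "h0 \<in> power_subset H Q" "S \<subseteq> power_subset K Q"
      using divisors by blast
    then have "Q > 0" by linarith
    have w: "\<exists>g\<in>carrier ?G. E g = (\<lambda>j. if j = i then unit i / of_nat Q else 0)" if i: "i \<in> I" for i
    proof (cases i)
      case None
      obtain h where h: "h \<in> carrier H" "h0 = h [^]\<^bsub>H\<^esub> Q" using Q(2) by (auto simp: power_subset_def)
      have "E (h, \<one>\<^bsub>K\<^esub>) = (\<lambda>j. if j = i then unit i / of_nat Q else 0)"
        using \<iota>_pow[OF h(1), of Q] \<open>Q > 0\<close> h(2) None
        by (intro ext, rename_tac j, case_tac j) (simp_all add: unit_def \<kappa>_1)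
      then show ?thesis using h(1) by (intro bexI[of _ "(h, \<one>\<^bsub>K\<^esub>)"]) simp_all
    next
      case (Some s)
      then have s: "s \<in> S" using i by (auto simp: I_def)
      then obtain k where k: "k \<in> carrier K" "s = k [^]\<^bsub>K\<^esub> Q"
        using Q(3) unfolding power_subset_def by blast
      have "of_nat Q * \<kappa> k t = (if t = s then 1 else 0)" for t
        using \<kappa>_pow[OF k(1), of Q t] \<kappa>_unit[OF s, of t] k(2) by simp
      then have "\<kappa> k t = (if t = s then 1 / of_nat Q else 0)" for t
        using \<open>Q > 0\<close> by (metis mult_eq_0_iff nonzero_mult_div_cancel_left of_nat_eq_0_iff less_irrefl)
      then have "E (\<one>\<^bsub>H\<^esub>, k) = (\<lambda>j. if j = i then unit i / of_nat Q else 0)"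
        using Some by (intro ext, rename_tac j, case_tac j) (simp_all add: unit_def \<iota>_1)
      then show ?thesis using k(1) by (intro bexI[of _ "(\<one>\<^bsub>H\<^esub>, k)"]) simp_all
    qed
    then have "(\<lambda>j. if j = i then unit i / of_nat Q else 0) \<in> E ` carrier ?G" if "i \<in> I" for i
      using that by (metis (no_types, lifting) image_eqI)
    then have "(\<lambda>j. \<Sum>i\<in>I. of_int (c i) * (if j = i then unit i / of_nat Q else 0)) \<in> E ` carrier ?G"
      by (rule vector_group_sum[OF V \<open>finite I\<close>])
    moreover have "(\<Sum>i\<in>I. of_int (c i) * (if j = i then unit i / of_nat Q else 0))
        = of_nat d * E x j / of_nat Q" for j
    proof (cases "j \<in> I")
      case True
      have "(\<Sum>i\<in>I. of_int (c i) * (if j = i then unit i / of_nat Q else 0))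
          = (\<Sum>i\<in>I. if j = i then of_int (c i) * unit i / of_nat Q else 0)"
        by (intro sum.cong) auto
      then show ?thesis using True \<open>finite I\<close> by (simp add: c)
    next
      case False
      then show ?thesis by (auto simp: E_supp intro!: sum.neutral)
    qed
    ultimately have "(\<lambda>j. of_nat d * E x j / of_nat Q) \<in> E ` carrier ?G" by simp
    from bezout_divisible[OF V imageI[OF x] d(1) \<open>Q > 0\<close> this]
    obtain N where N: "Q \<le> N * d" "(\<lambda>i. E x i / of_nat N) \<in> E ` carrier ?G" by blast
    have "M * d < N * d" using Q(1) N(1) by linarith
    then show ?thesis using N(2) by auto
  qed
  have pos: "pos_cone ?G = {x \<in> carrier ?G. E x None > 0} \<union> {\<one>\<^bsub>?G\<^esub>}"
    by auto
  have "finite I" using fin by (simp add: I_def)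
  show ?thesis
  proof (rule ultrasimplicial_if_divisible_vectors[OF G E_mult E_inj \<open>finite I\<close> E_supp divisible pos])
    show "(h0, \<one>\<^bsub>K\<^esub>) \<in> carrier ?G" "E (h0, \<one>\<^bsub>K\<^esub>) None \<noteq> 0" using h0 \<iota>_h0 by simp_all
  qed
qed

theorem proposition4p2:
  fixes H :: "('h, 'm) monoid_scheme"
    and \<iota> :: "'h \<Rightarrow> rat"
    and K :: "('k, 'n) monoid_scheme"
  assumes "comm_group H" "torsion_free H" "has_rank H 1"
    and "\<iota> \<in> mon H rat_group"
    and "comm_group K" "torsion_free K" "finite_rank K" "carrier K \<noteq> {\<one>\<^bsub>K\<^esub>}"
    and "inf (inner_type K) (rank_one_type H) \<noteq> rank_one_type integer_group"
  shows "ultrasimplicial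
           (with_cone (H \<times>\<times> K)
              ({(h, k). h \<in> carrier H \<and> k \<in> carrier K \<and> \<iota> h > 0} \<union> {\<one>\<^bsub>H \<times>\<times> K\<^esub>}))"
proof -
  interpret H: comm_group H by fact
  interpret K: comm_group K by fact
  define h0 where "h0 = (SOME a. a \<in> carrier H - {\<one>\<^bsub>H\<^esub>})"
  have "\<exists>a. a \<in> carrier H - {\<one>\<^bsub>H\<^esub>}"
  proof -
    obtain a where a: "int_independent H {a}"
      using assms(3) by (auto simp: has_rank_def maximal_int_independent_def card_1_singleton_iff)
    have "a \<noteq> \<one>\<^bsub>H\<^esub>"
      using int_independentD[OF a, of "{a}" "\<lambda>_. 1" a] a by (auto simp: int_independent_def)
    then show ?thesis using a by (auto simp: int_independent_def)
  qed
  then have "h0 \<in> carrier H - {\<one>\<^bsub>H\<^esub>}" unfolding h0_def by (rule someI_ex)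
  then have h0: "h0 \<in> carrier H" "h0 \<noteq> \<one>\<^bsub>H\<^esub>" by auto
  define S where "S = (SOME S. maximal_int_independent K S \<and> finite S)"
  have "\<exists>S. maximal_int_independent K S \<and> finite S"
    using assms(7) by (auto simp: finite_rank_def has_rank_def)
  then have "maximal_int_independent K S \<and> finite S" unfolding S_def by (rule someI_ex)
  then have S: "maximal_int_independent K S" "finite S" by auto
  then have SK: "S \<subseteq> carrier K" by (simp add: maximal_int_independent_def int_independent_def)
  have "S \<noteq> {}"
  proof
    assume "S = {}"
    obtain \<kappa> :: "'k \<Rightarrow> 'k \<Rightarrow> rat" where inj: "inj_on \<kappa> (carrier K)"
      and supp: "\<And>k s. s \<notin> S \<Longrightarrow> \<kappa> k s = 0"
      by (rule rational_coordinates[OF assms(5,6) S]) (rule that)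
    have "\<kappa> k = \<kappa> \<one>\<^bsub>K\<^esub>" for k using supp \<open>S = {}\<close> by (simp add: fun_eq_iff)
    then have "k = \<one>\<^bsub>K\<^esub>" if "k \<in> carrier K" for k using inj that by (metis K.one_closed inj_onD)
    then show False using assms(8) by auto
  qed
  have "inf (Inf_fin (element_type K ` S)) (element_type H h0) \<noteq> rank_one_type integer_group"
    using assms(9) by (simp add: inner_type_def rank_one_type_def[of H] S_def h0_def)
  then have "\<exists>Q>B. h0 \<in> power_subset H Q \<and> S \<subseteq> power_subset K Q" for B
    using K.group_axioms H.group_axioms S(2) \<open>S \<noteq> {}\<close> SK h0(1)
    by (intro unbounded_common_divisors)
  then show ?thesis
    by (intro direct_sum_ultrasimplicial[OF assms(1,5,4) h0 assms(6) S])
qed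

end
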